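(* For each vector $x=[U,V]\in X_{\mathcal S}$ the following inequality holds: $$o([U,V])^2\ \ge\ 4\pi\, m([U,V]).$$
   Context: $\mathcal S$ is the family of all non-empty, compact, convex, centrally symmetric ($V=-V$) subsets of $\mathbb R^2$, with Minkowski addition and multiplication $\lambda V=\{\lambda v: v\in V\}$ by scalars $\lambda\ge 0$. Sets with empty interior are allowed; $\theta$ is the origin. $X_{\mathcal S}$ is the real vector space $(\mathcal S\times\mathcal S)/\diamond$, where $(U,V)\diamond(P,Q)\iff U+Q=V+P$, with operations $[U,V]+[P,Q]=[U+P,V+Q]$, $\lambda[U,V]=[\lambda U,\lambda V]$ for $\lambda\ge0$, and $(-1)[U,V]=[V,U]$. For $U\in\mathcal S$, $m(U)$ is the two-dimensional Lebesgue measure and $o(U)$ is the perimeter, i.e. the coefficient in Steiner's formula $m(U+\lambda B)=m(U)+\lambda o(U)+\lambda^2 m(B)$, $\lambda\ge 0$, with $B$ the closed unit disc (so a segment of length $\ell$ has perimeter $2\ell$). These are extended to $X_{\mathcal S}$ by $m([U,V])=2m(U)+2m(V)-m(U+V)$ (a quadratic form) and $o([U,V])=o(U)-o(V)$ (a linear functional); both are independent of the choice of representative. Note that $m([U,V])$ may be negative. *)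

theory Defs
  imports "HOL-Analysis.Analysis" "HOL-Library.Set_Algebras"
begin

typedef sym_body = "{V :: (real^2) set. V \<noteq> {} \<and> compact V \<and> convex V \<and> V = uminus ` V}"
  morphisms body Abs_sym_body
  by (rule exI[of _ "{0}"]) auto

setup_lifting type_definition_sym_body

lemma minkowski_cancel:
  fixes U V W :: "(real^2) set"
  assumes V: "closed V" "convex V" and W: "compact W" "W \<noteq> {}"
    and le: "U + W \<subseteq> V + W"
  shows "U \<subseteq> V"
proof
  fix z assume z: "z \<in> U"
  show "z \<in> V"
  proof (rule ccontr)
    assume "z \<notin> V"
    then obtain a b where ab: "inner a z < b" "\<And>x. x \<in> V \<Longrightarrow> inner a x > b"
      using separating_hyperplane_closed_point[OF V(2,1)] by blast
    have "continuous_on W (\<lambda>w. inner a w)" by (intro continuous_intros)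
    then obtain w where w: "w \<in> W" "\<And>y. y \<in> W \<Longrightarrow> inner a w \<le> inner a y"
      using continuous_attains_inf[OF W] by blast
    have "z + w \<in> V + W" using z w(1) le by (meson set_plus_intro subsetD)
    then obtain v y where vy: "z + w = v + y" "v \<in> V" "y \<in> W" by (auto elim: set_plus_elim)
    have "inner a z + inner a w = inner a v + inner a y"
      using vy(1) by (metis inner_add_right)
    then show False using ab w(2)[OF vy(3)] vy(2) by fastforce
  qed
qed

lemma convex_scaleR_add:
  fixes V :: "(real^2) set"
  assumes "convex V" "0 \<le> r" "0 \<le> s"
  shows "(*\<^sub>R) (r + s) ` V = (*\<^sub>R) r ` V + (*\<^sub>R) s ` V"
proof (rule set_eqI, rule iffI)
  fix x assume "x \<in> (*\<^sub>R) (r + s) ` V"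
  then show "x \<in> (*\<^sub>R) r ` V + (*\<^sub>R) s ` V"
    by (auto simp: scaleR_left_distrib intro!: set_plus_intro)
next
  fix x assume "x \<in> (*\<^sub>R) r ` V + (*\<^sub>R) s ` V"
  then obtain u v where uv: "u \<in> V" "v \<in> V" "x = r *\<^sub>R u + s *\<^sub>R v"
    by (auto elim!: set_plus_elim)
  show "x \<in> (*\<^sub>R) (r + s) ` V"
  proof (cases "r + s = 0")
    case True
    then have "r = 0" "s = 0" using assms by auto
    then show ?thesis using uv by force
  next
    case False
    have "(r/(r+s)) *\<^sub>R u + (s/(r+s)) *\<^sub>R v \<in> V"
      using False assms uv by (intro convexD[OF assms(1)]) (auto simp: add_divide_distrib[symmetric])
    moreover have "x = (r+s) *\<^sub>R ((r/(r+s)) *\<^sub>R u + (s/(r+s)) *\<^sub>R v)"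
      using False uv(3) by (simp add: scaleR_right_distrib)
    ultimately show ?thesis by blast
  qed
qed

lemma uminus_image_set_plus:
  fixes U V :: "(real^2) set"
  shows "uminus ` (U + V) = uminus ` U + uminus ` V"
proof (rule set_eqI, rule iffI)
  fix x assume "x \<in> uminus ` (U + V)"
  then obtain u v where "u \<in> U" "v \<in> V" "x = - (u + v)" by (auto elim!: set_plus_elim)
  then show "x \<in> uminus ` U + uminus ` V"
    using set_plus_intro[of "-u" "uminus ` U" "-v" "uminus ` V"] by auto
next
  fix x assume "x \<in> uminus ` U + uminus ` V"
  then obtain u v where uv: "u \<in> U" "v \<in> V" "x = - (u + v)" by (auto elim!: set_plus_elim)
  from uv(1,2) have "u + v \<in> U + V" by (rule set_plus_intro)
  then show "x \<in> uminus ` (U + V)" by (simp only: uv(3) imageI)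
qed

lemma scaleR_image_set_plus:
  fixes U V :: "(real^2) set"
  shows "(*\<^sub>R) r ` (U + V) = (*\<^sub>R) r ` U + (*\<^sub>R) r ` V"
proof (rule set_eqI, rule iffI)
  fix x assume "x \<in> (*\<^sub>R) r ` (U + V)"
  then obtain u v where "u \<in> U" "v \<in> V" "x = r *\<^sub>R u + r *\<^sub>R v"
    by (auto elim!: set_plus_elim simp: scaleR_right_distrib)
  then show "x \<in> (*\<^sub>R) r ` U + (*\<^sub>R) r ` V" by auto
next
  fix x assume "x \<in> (*\<^sub>R) r ` U + (*\<^sub>R) r ` V"
  then obtain u v where "u \<in> U" "v \<in> V" "x = r *\<^sub>R (u + v)"
    by (auto elim!: set_plus_elim simp: scaleR_right_distrib)
  then show "x \<in> (*\<^sub>R) r ` (U + V)" by auto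
qed

lemma compact_set_plus:
  fixes U V :: "(real^2) set"
  assumes "compact U" "compact V"
  shows "compact (U + V)"
proof -
  have "U + V = {x + y |x y. x \<in> U \<and> y \<in> V}" by (auto simp: set_plus_def)
  then show ?thesis using compact_sums[OF assms] by simp
qed

instantiation sym_body :: comm_monoid_add
begin

lift_definition zero_sym_body :: sym_body is "{0}" by auto

lift_definition plus_sym_body :: "sym_body \<Rightarrow> sym_body \<Rightarrow> sym_body" is "\<lambda>U V. U + V"
proof -
  fix U V :: "(real^2) set"
  assume U: "U \<noteq> {} \<and> compact U \<and> convex U \<and> U = uminus ` U"
    and V: "V \<noteq> {} \<and> compact V \<and> convex V \<and> V = uminus ` V"
  then have "U + V = uminus ` (U + V)" by (metis uminus_image_set_plus)
  moreover have "U + V \<noteq> {}" using U V set_plus_intro by blast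
  ultimately show "U + V \<noteq> {} \<and> compact (U + V) \<and> convex (U + V) \<and> U + V = uminus ` (U + V)"
    using U V compact_set_plus convex_set_plus by blast
qed

instance
proof
  fix U V W :: sym_body
  show "U + V + W = U + (V + W)" by transfer (simp add: add.assoc)
  show "U + V = V + U" by transfer (simp add: add.commute)
  show "0 + U = U" by transfer (simp add: set_plus_def)
qed

end

lemma sym_body_add_right_cancel:
  fixes U V W :: sym_body
  assumes "U + W = V + W"
  shows "U = V"
proof -
  have closed: "closed (body A)" "convex (body A)" "compact (body A)" "body A \<noteq> {}" for A
    using body[of A, unfolded mem_Collect_eq] compact_imp_closed by blast+
  have "body U + body W = body V + body W"
    using assms by (metis plus_sym_body.rep_eq)
  then have "body U \<subseteq> body V" "body V \<subseteq> body U"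
    using minkowski_cancel[OF closed(1,2)[of V] closed(3,4)[of W]]
      minkowski_cancel[OF closed(1,2)[of U] closed(3,4)[of W]] by blast+
  then show ?thesis by (simp only: body_inject[symmetric] subset_antisym)
qed

lift_definition scale_body :: "real \<Rightarrow> sym_body \<Rightarrow> sym_body" is "\<lambda>r V. (*\<^sub>R) r ` V"
proof -
  fix r :: real and V :: "(real^2) set"
  assume V: "V \<noteq> {} \<and> compact V \<and> convex V \<and> V = uminus ` V"
  have "uminus ` (*\<^sub>R) r ` V = (*\<^sub>R) r ` (uminus ` V)" by (simp add: image_image)
  moreover have "uminus ` V = V" using V by blast
  ultimately have "(*\<^sub>R) r ` V = uminus ` (*\<^sub>R) r ` V" by simp
  then show "(*\<^sub>R) r ` V \<noteq> {} \<and> compact ((*\<^sub>R) r ` V) \<and> convex ((*\<^sub>R) r ` V)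
      \<and> (*\<^sub>R) r ` V = uminus ` (*\<^sub>R) r ` V"
    using V compact_scaling convex_scaling by blast
qed

lemma scale_body_add_right: "scale_body r (U + V) = scale_body r U + scale_body r V"
  by (simp add: body_inject[symmetric] scale_body.rep_eq plus_sym_body.rep_eq scaleR_image_set_plus)

lemma scale_body_add_left:
  assumes "0 \<le> r" "0 \<le> s"
  shows "scale_body (r + s) V = scale_body r V + scale_body s V"
proof -
  have "convex (body V)" using body[of V, unfolded mem_Collect_eq] by blast
  then show ?thesis
    using assms by (simp add: body_inject[symmetric] scale_body.rep_eq plus_sym_body.rep_eq
        convex_scaleR_add)
qed

lemma scale_body_scale_body: "scale_body r (scale_body s V) = scale_body (r * s) V"
  by (simp add: body_inject[symmetric] scale_body.rep_eq image_image)

lemma scale_body_one: "scale_body 1 V = V"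
  by (simp add: body_inject[symmetric] scale_body.rep_eq)

lemma scale_body_zero: "scale_body 0 V = 0"
proof -
  have "body V \<noteq> {}" using body[of V, unfolded mem_Collect_eq] by blast
  then show ?thesis
    by (simp add: body_inject[symmetric] scale_body.rep_eq zero_sym_body.rep_eq
        image_constant_conv)
qed

lift_definition unit_disc :: sym_body is "cball 0 1"
proof -
  have "x \<in> uminus ` cball 0 1" if "x \<in> cball 0 1" for x :: "real^2"
    using that by (intro image_eqI[of _ _ "- x"]) simp_all
  then show "cball (0 :: real^2) 1 \<noteq> {} \<and> compact (cball (0 :: real^2) 1) \<and>
      convex (cball (0 :: real^2) 1) \<and> cball (0 :: real^2) 1 = uminus ` cball 0 1"
    by auto
qed

definition body_area :: "sym_body \<Rightarrow> real" where
  "body_area U = measure lebesgue (body U)"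

definition body_perimeter :: "sym_body \<Rightarrow> real" where
  "body_perimeter U = (THE c. \<forall>r\<ge>0. body_area (U + scale_body r unit_disc)
     = body_area U + r * c + r\<^sup>2 * body_area unit_disc)"

definition diamond :: "sym_body \<times> sym_body \<Rightarrow> sym_body \<times> sym_body \<Rightarrow> bool" where
  "diamond = (\<lambda>(U, V) (P, Q). U + Q = V + P)"

lemma equivp_diamond: "equivp diamond"
proof (rule equivpI)
  show "reflp diamond" by (auto simp: reflp_def diamond_def add.commute)
  show "symp diamond" by (auto simp: symp_def diamond_def add.commute)
  show "transp diamond"
  proof (rule transpI)
    fix x y z assume xy: "diamond x y" and yz: "diamond y z"
    obtain U V where x: "x = (U, V)" by (cases x)
    obtain P Q where y: "y = (P, Q)" by (cases y)
    obtain S T where z: "z = (S, T)" by (cases z)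
    have 1: "U + Q = V + P" and 2: "P + T = Q + S"
      using xy yz by (simp_all add: x y z diamond_def)
    have "(U + T) + Q = (U + Q) + T" by (simp only: ac_simps)
    also have "\<dots> = V + (P + T)" by (simp only: 1 add.assoc)
    also have "\<dots> = (V + S) + Q" by (simp only: 2 ac_simps)
    finally have "U + T = V + S" by (rule sym_body_add_right_cancel)
    then show "diamond x z" by (simp add: x z diamond_def)
  qed
qed

quotient_type sym_vec = "sym_body \<times> sym_body" / diamond
  by (rule equivp_diamond)

definition sym_class :: "sym_body \<Rightarrow> sym_body \<Rightarrow> sym_vec" where
  "sym_class U V = abs_sym_vec (U, V)"

lemma sym_class_eq_iff: "sym_class U V = sym_class P Q \<longleftrightarrow> U + Q = V + P"
  by (simp add: sym_class_def sym_vec.abs_eq_iff diamond_def)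

lemma sym_class_cases: obtains U V where "x = sym_class U V"
  by (metis Quotient3_abs_rep Quotient3_sym_vec sym_class_def surj_pair)

instantiation sym_vec :: ab_group_add
begin

lift_definition zero_sym_vec :: sym_vec is "(0, 0)" .

lift_definition plus_sym_vec :: "sym_vec \<Rightarrow> sym_vec \<Rightarrow> sym_vec"
  is "\<lambda>(U, V) (P, Q). (U + P, V + Q)"
proof -
  fix a b c d assume "diamond a b" "diamond c d"
  moreover obtain A A' where a: "a = (A, A')" by (cases a)
  moreover obtain B B' where b: "b = (B, B')" by (cases b)
  moreover obtain C C' where c: "c = (C, C')" by (cases c)
  moreover obtain D D' where d: "d = (D, D')" by (cases d)
  ultimately have 1: "A + B' = A' + B" and 2: "C + D' = C' + D" by (simp_all add: diamond_def)
  have "(A + C) + (B' + D') = (A + B') + (C + D')" by (simp only: ac_simps)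
  also have "\<dots> = (A' + B) + (C' + D)" by (simp only: 1 2)
  also have "\<dots> = (A' + C') + (B + D)" by (simp only: ac_simps)
  finally show "diamond ((\<lambda>(U, V) (P, Q). (U + P, V + Q)) a c) ((\<lambda>(U, V) (P, Q). (U + P, V + Q)) b d)"
    by (simp add: a b c d diamond_def)
qed

lift_definition uminus_sym_vec :: "sym_vec \<Rightarrow> sym_vec" is "\<lambda>(U, V). (V, U)"
  by (auto simp: diamond_def)

definition minus_sym_vec :: "sym_vec \<Rightarrow> sym_vec \<Rightarrow> sym_vec" where
  "minus_sym_vec x y = x + - y"

lemma plus_sym_class: "sym_class U V + sym_class P Q = sym_class (U + P) (V + Q)"
  by (simp add: sym_class_def plus_sym_vec.abs_eq)

lemma uminus_sym_class: "- sym_class U V = sym_class V U"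
  by (simp add: sym_class_def uminus_sym_vec.abs_eq)

lemma zero_sym_class: "0 = sym_class 0 0"
  by (simp add: sym_class_def zero_sym_vec.abs_eq)

instance
proof
  fix x y z :: sym_vec
  obtain U V where x: "x = sym_class U V" by (rule sym_class_cases)
  obtain P Q where y: "y = sym_class P Q" by (rule sym_class_cases)
  obtain S T where z: "z = sym_class S T" by (rule sym_class_cases)
  show "x + y + z = x + (y + z)" by (simp add: x y z plus_sym_class add.assoc)
  show "x + y = y + x" by (simp add: x y plus_sym_class add.commute)
  show "0 + x = x" by (simp add: x plus_sym_class zero_sym_class)
  show "- x + x = 0"
    by (simp add: x plus_sym_class zero_sym_class uminus_sym_class sym_class_eq_iff add.commute)
  show "x - y = x + - y" by (rule minus_sym_vec_def)
qed

end

instantiation sym_vec :: real_vector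
begin

lift_definition scaleR_sym_vec :: "real \<Rightarrow> sym_vec \<Rightarrow> sym_vec" is
  "\<lambda>r (U, V). if 0 \<le> r then (scale_body r U, scale_body r V)
     else (scale_body (- r) V, scale_body (- r) U)"
  by (auto simp: diamond_def split: if_splits simp flip: scale_body_add_right)

lemma scaleR_sym_class_nonneg:
  "0 \<le> r \<Longrightarrow> r *\<^sub>R sym_class U V = sym_class (scale_body r U) (scale_body r V)"
  by (simp add: sym_class_def scaleR_sym_vec.abs_eq)

lemma scaleR_sym_class_nonpos:
  assumes "r \<le> 0"
  shows "r *\<^sub>R sym_class U V = sym_class (scale_body (- r) V) (scale_body (- r) U)"
proof (cases "r = 0")
  case True
  then show ?thesis by (simp add: scaleR_sym_class_nonneg scale_body_zero)
next
  case False
  then show ?thesis using assms by (simp add: sym_class_def scaleR_sym_vec.abs_eq)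
qed

lemma scaleR_sym_vec_minus_left: "(- r) *\<^sub>R x = - (r *\<^sub>R x)" for x :: sym_vec
proof -
  obtain U V where "x = sym_class U V" by (rule sym_class_cases)
  then show ?thesis
    by (cases "0 \<le> r")
      (simp_all add: scaleR_sym_class_nonneg scaleR_sym_class_nonpos uminus_sym_class)
qed

lemma scaleR_sym_vec_add_left_nonneg:
  "0 \<le> r \<Longrightarrow> 0 \<le> s \<Longrightarrow> (r + s) *\<^sub>R x = r *\<^sub>R x + s *\<^sub>R x" for x :: sym_vec
  by (rule sym_class_cases[of x])
    (simp add: scaleR_sym_class_nonneg plus_sym_class scale_body_add_left)

lemma scaleR_sym_vec_add_left_nonneg_sum:
  fixes x :: sym_vec
  assumes "0 \<le> r + s"
  shows "(r + s) *\<^sub>R x = r *\<^sub>R x + s *\<^sub>R x"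
proof -
  consider "0 \<le> r" "0 \<le> s" | "0 \<le> r" "s \<le> 0" | "r \<le> 0" "0 \<le> s"
    using assms by linarith
  then show ?thesis
  proof cases
    case 1
    then show ?thesis by (rule scaleR_sym_vec_add_left_nonneg)
  next
    case 2
    then show ?thesis
      using scaleR_sym_vec_add_left_nonneg[of "r + s" "- s" x] assms
      by (simp add: scaleR_sym_vec_minus_left)
  next
    case 3
    then show ?thesis
      using scaleR_sym_vec_add_left_nonneg[of "r + s" "- r" x] assms
      by (simp add: scaleR_sym_vec_minus_left)
  qed
qed

instance
proof
  fix x y :: sym_vec and r s :: real
  obtain U V where x: "x = sym_class U V" by (rule sym_class_cases)
  obtain P Q where y: "y = sym_class P Q" by (rule sym_class_cases)
  show "r *\<^sub>R (x + y) = r *\<^sub>R x + r *\<^sub>R y"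
    by (cases "0 \<le> r") (simp_all add: x y plus_sym_class scaleR_sym_class_nonneg
        scaleR_sym_class_nonpos scale_body_add_right)
  show "1 *\<^sub>R x = x" by (simp add: x scaleR_sym_class_nonneg scale_body_one)
  show "r *\<^sub>R s *\<^sub>R x = (r * s) *\<^sub>R x"
    by (cases "0 \<le> r"; cases "0 \<le> s") (simp_all add: x scaleR_sym_class_nonneg
        scaleR_sym_class_nonpos scale_body_scale_body mult_nonneg_nonpos mult_nonpos_nonneg
        mult_nonpos_nonpos)
  show "(r + s) *\<^sub>R x = r *\<^sub>R x + s *\<^sub>R x"
  proof (cases "0 \<le> r + s")
    case True
    then show ?thesis by (rule scaleR_sym_vec_add_left_nonneg_sum)
  next
    case False
    then have "(- r + - s) *\<^sub>R x = (- r) *\<^sub>R x + (- s) *\<^sub>R x"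
      by (intro scaleR_sym_vec_add_left_nonneg_sum) simp
    moreover have "(- r + - s) *\<^sub>R x = - ((r + s) *\<^sub>R x)"
      using scaleR_sym_vec_minus_left[of "r + s" x] by simp
    ultimately have "- ((r + s) *\<^sub>R x) = - (r *\<^sub>R x + s *\<^sub>R x)"
      by (simp add: scaleR_sym_vec_minus_left)
    then show ?thesis by (simp only: neg_equal_iff_equal)
  qed
qed

end

text \<open>Both extensions to classes do not depend on the representative; the descriptions
  below quantify over all representatives rather than selecting one.\<close>

definition vec_area :: "sym_vec \<Rightarrow> real" where
  "vec_area x = (THE a. \<forall>U V. x = sym_class U V \<longrightarrow>
     a = 2 * body_area U + 2 * body_area V - body_area (U + V))"

definition vec_perimeter :: "sym_vec \<Rightarrow> real" where
  "vec_perimeter x = (THE c. \<forall>U V. x = sym_class U V \<longrightarrow>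
     c = body_perimeter U - body_perimeter V)"

end

theory Submission
  imports Defs
begin

text \<open>Write \<open>M(U,V)\<close> for the mixed area, \<open>2 M(U,V) = m(U + V) - m(U) - m(V)\<close>. Adding a segment to
  \<open>K\<close> increases \<open>m(K)\<close> by a multiple of a width of \<open>K\<close>, which is additive in \<open>K\<close>; hence \<open>M\<close> is
  biadditive when one argument is a zonotope, and in general because planar symmetric bodies are
  limits of zonotopes. So \<open>o(U) = 2 M(U,B)\<close> and \<open>m([U,V]) = m(U) + m(V) - 2 M(U,V)\<close>.

  If \<open>o(U) = o(V)\<close>, then \<open>U\<close> and \<open>V\<close> have the same width in some direction: otherwise, by
  connectedness of the circle, one of them plus a small disc would be contained in the other. Their
  projections to that direction coincide by symmetry, and Fubini applied to the sections over this
  projection gives Bonnesen's inequality \<open>m(U + V) \<ge> 2 m(U) + 2 m(V)\<close>, that is \<open>m([U,V]) \<le> 0\<close>. If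
  \<open>o(U) \<ge> o(V)\<close>, apply this to \<open>U\<close> and \<open>V + c B\<close> with \<open>2 \<pi> c = o(U) - o(V)\<close>.\<close>

subsection \<open>Sections of planar sets\<close>

definition slice :: "(real^2) set \<Rightarrow> real \<Rightarrow> real set" where
  "slice K t = {y. vector [t, y] \<in> K}"

lemma vec2_eq: "(x :: real^2) = vector [x $ 1, x $ 2]"
  by (simp add: vec_eq_iff forall_2)

lemma slice_iff: "x \<in> K \<longleftrightarrow> x $ 2 \<in> slice K (x $ 1)"
  using vec2_eq[of x] by (simp add: slice_def)

lemma continuous_on_vector2:
  fixes f g :: "'a :: t2_space \<Rightarrow> real"
  assumes "continuous_on S f" "continuous_on S g"
  shows "continuous_on S (\<lambda>x. vector [f x, g x] :: real^2)"
proof (subst continuous_on_componentwise, rule ballI)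
  fix b :: "real^2" assume "b \<in> Basis"
  then obtain i where "b = axis i 1" by (auto simp: Basis_vec_def)
  then show "continuous_on S (\<lambda>x. (vector [f x, g x] :: real^2) \<bullet> b)"
    using assms exhaust_2[of i] by (auto simp: inner_axis)
qed

section \<open>Area as the integral of section lengths\<close>

lemma measurable_vector2: "(\<lambda>(a, b). vector [a, b] :: real^2) \<in> borel_measurable lborel"
proof -
  have "(\<lambda>(a, b). vector [a, b] :: real^2) \<in> borel_measurable borel"
    by (rule borel_measurable_continuous_onI)
      (auto simp: case_prod_unfold intro!: continuous_on_vector2 continuous_intros)
  then show ?thesis by simp
qed

text \<open>Identifies the plane \<open>real^2\<close> with a product of two lines, so that the
  Fubini theorem for product measures applies. Lebesgue measure is determined by its values on
  boxes, where both sides give the product of the side lengths.\<close>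

lemma lborel_real2: "(lborel :: (real^2) measure) = distr lborel borel (\<lambda>(a, b). vector [a, b])"
proof (rule lborel_eqI)
  note meas = measurable_vector2
  fix l u :: "real^2"
  assume le: "\<And>b. b \<in> Basis \<Longrightarrow> l \<bullet> b \<le> u \<bullet> b"
  have le': "l $ i \<le> u $ i" for i
    using le[of "axis i 1"] by (simp add: inner_axis axis_in_Basis_iff)
  have "(\<lambda>(a, b). vector [a, b] :: real^2) -` box l u
      = {l $ 1 <..< u $ 1} \<times> {l $ 2 <..< u $ 2}"
    by (auto simp: mem_box_cart forall_2)
  then have "emeasure (distr lborel borel (\<lambda>(a, b). vector [a, b])) (box l u)
      = emeasure lborel ({l $ 1 <..< u $ 1} \<times> {l $ 2 <..< u $ 2})"
    using meas by (subst emeasure_distr) auto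
  also have "\<dots> = emeasure lborel {l $ 1 <..< u $ 1} * emeasure lborel {l $ 2 <..< u $ 2}"
    by (subst lborel_prod[symmetric], rule lborel.emeasure_pair_measure_Times) auto
  also have "\<dots> = ennreal ((u $ 1 - l $ 1) * (u $ 2 - l $ 2))"
    using le' by (simp add: ennreal_mult')
  also have "(u $ 1 - l $ 1) * (u $ 2 - l $ 2) = (\<Prod>b\<in>Basis. (u - l) \<bullet> b)"
  proof -
    have B: "(Basis :: (real^2) set) = {axis 1 1, axis 2 1}"
      by (auto simp: Basis_vec_def) (metis exhaust_2)
    show ?thesis unfolding B by (simp add: inner_axis axis_eq_axis)
  qed
  finally show "emeasure (distr lborel borel (\<lambda>(a, b). vector [a, b])) (box l u)
      = ennreal (\<Prod>b\<in>Basis. (u - l) \<bullet> b)" .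
qed simp

lemma compact_slice:
  assumes "compact K"
  shows "compact (slice K t)"
proof -
  have "closed (slice K t)"
    using closed_vimage[OF compact_imp_closed[OF assms], of "\<lambda>y. vector [t, y]"]
    by (simp add: slice_def vimage_def continuous_on_vector2)
  moreover have "slice K t \<subseteq> (\<lambda>x. x $ 2) ` K"
    by (auto simp: slice_def image_iff) (metis vector_2(2))
  moreover have "compact ((\<lambda>x. x $ 2) ` K)"
    by (intro compact_continuous_image assms continuous_intros)
  ultimately show ?thesis
    by (metis compact_Int_closed inf.absorb2 Int_commute)
qed

lemma convex_slice:
  assumes "convex K"
  shows "convex (slice K t)"
proof (rule convexI)
  fix x y u v :: real
  assume "x \<in> slice K t" "y \<in> slice K t" and uv: "0 \<le> u" "0 \<le> v" "u + v = 1"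
  then have "u *\<^sub>R vector [t, x] + v *\<^sub>R vector [t, y] \<in> K"
    using convexD[OF assms] by (simp add: slice_def)
  moreover have "u *\<^sub>R vector [t, x] + v *\<^sub>R vector [t, y] = (vector [t, u * x + v * y] :: real^2)"
    using uv by (simp add: vec_eq_iff forall_2 distrib_right[symmetric])
  ultimately show "u *\<^sub>R x + v *\<^sub>R y \<in> slice K t" by (simp add: slice_def)
qed

lemma slice_interval:
  assumes "compact K" "convex K" "slice K t \<noteq> {}"
  obtains a b where "a \<le> b" "slice K t = {a..b}"
proof -
  have "compact (slice K t)" "connected (slice K t)"
    using assms compact_slice convex_slice convex_connected by blast+
  then obtain a b where "slice K t = {a..b}"
    using connected_compact_interval_1[of "slice K t"] by blast
  then show thesis using that assms(3) by force
qed

text \<open>Cavalieri's principle: in coordinates, \<open>K\<close> becomes a measurable set of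
  pairs whose section at \<open>t\<close> is \<open>slice K t\<close>. Working with extended
  nonnegative integrals avoids integrability conditions.\<close>

lemma emeasure_slices:
  fixes K :: "(real^2) set"
  assumes "compact K"
  shows "emeasure lborel K = (\<integral>\<^sup>+ t. emeasure lborel (slice K t) \<partial>lborel)"
    and "(\<lambda>t. emeasure lborel (slice K t)) \<in> borel_measurable borel"
proof -
  note meas = measurable_vector2
  have K: "K \<in> sets borel" using assms by (simp add: borel_compact)
  let ?P = "{p. vector [fst p, snd p] \<in> K}"
  have P: "?P \<in> sets (lborel \<Otimes>\<^sub>M lborel)"
    unfolding lborel_prod using measurable_sets[OF meas K] by (simp add: vimage_def case_prod_unfold)
  have eq: "Pair t -` ?P = slice K t" for t by (auto simp: slice_def)
  have "emeasure lborel K = emeasure lborel ?P"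
    using meas K by (subst lborel_real2, subst emeasure_distr) (simp_all add: vimage_def case_prod_unfold)
  also have "\<dots> = (\<integral>\<^sup>+ t. emeasure lborel (slice K t) \<partial>lborel)"
    using lborel.emeasure_pair_measure_alt[OF P, unfolded eq] by (simp add: lborel_prod)
  finally show "emeasure lborel K = (\<integral>\<^sup>+ t. emeasure lborel (slice K t) \<partial>lborel)" .
  show "(\<lambda>t. emeasure lborel (slice K t)) \<in> borel_measurable borel"
    using lborel.measurable_emeasure_Pair[OF P, unfolded eq] by simp
qed

lemma emeasure_compact:
  fixes K :: "'a :: euclidean_space set"
  assumes "compact K"
  shows "emeasure lborel K = ennreal (measure lebesgue K)"
  using assms lmeasurable_compact[of K] emeasure_eq_measure2[of K lebesgue]
  by (simp add: borel_compact)

lemma set_plus_iff: "x \<in> A + B \<longleftrightarrow> (\<exists>a\<in>A. \<exists>b\<in>B. x = a + b)"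
  by (auto simp: set_plus_def)

lemma slice_nonempty_iff: "slice K t \<noteq> {} \<longleftrightarrow> t \<in> (\<lambda>x. x $ 1) ` K"
  by (auto simp: slice_def image_iff) (metis vector_2(1), metis vec2_eq)

text \<open>Every nonempty vertical section of \<open>K\<close> is an interval, which the segment
  lengthens by \<open>s\<close> at both ends; empty sections stay empty. Integrating the gain
  \<open>2 * s\<close> over the projection of \<open>K\<close> gives the formula.\<close>

lemma measure_plus_vertical_segment:
  fixes K :: "(real^2) set"
  assumes K: "compact K" "convex K" and s: "0 \<le> s"
  shows "measure lebesgue (K + {x. x $ 1 = 0 \<and> \<bar>x $ 2\<bar> \<le> s})
    = measure lebesgue K + 2 * s * measure lebesgue ((\<lambda>x. x $ 1) ` K)"
proof -
  define S :: "(real^2) set" where "S = {x. x $ 1 = 0 \<and> \<bar>x $ 2\<bar> \<le> s}"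
  let ?I = "(\<lambda>x. x $ 1) ` K"
  have I: "compact ?I" by (intro compact_continuous_image K continuous_intros)
  have "S = cbox (vector [0, - s]) (vector [0, s])"
    by (auto simp: S_def mem_box_cart forall_2)
  then have S: "compact S" by simp
  then have KS: "compact (K + S)" by (rule compact_set_plus[OF K(1)])
  have sl: "emeasure lborel (slice (K + S) t)
      = emeasure lborel (slice K t) + ennreal (2 * s) * indicator ?I t" for t
  proof (cases "slice K t = {}")
    case True
    have "slice (K + S) t = {}"
    proof (rule ccontr)
      assume "slice (K + S) t \<noteq> {}"
      then obtain a b where "a \<in> K" "b \<in> S" "t = (a + b) $ 1"
        unfolding slice_nonempty_iff by (auto simp: set_plus_iff)
      then show False using True slice_iff[of a K] by (auto simp: S_def)
    qed
    then show ?thesis using True slice_nonempty_iff[of K t] by (auto simp: indicator_def)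
  next
    case False
    then obtain a b where ab: "a \<le> b" "slice K t = {a..b}" using slice_interval[OF K] by metis
    have "slice (K + S) t = {a - s..b + s}"
    proof (intro set_eqI iffI)
      fix y assume "y \<in> slice (K + S) t"
      then obtain p q where pq: "p \<in> K" "q \<in> S" "vector [t, y] = p + q"
        by (auto simp: slice_def set_plus_iff)
      then have "p $ 1 = t" "p $ 2 + q $ 2 = y"
        using pq(2,3) by (auto simp: S_def vec_eq_iff forall_2 )
      then show "y \<in> {a - s..b + s}" using ab(2) slice_iff[of p K] pq by (auto simp: S_def)
    next
      fix y assume y: "y \<in> {a - s..b + s}"
      \<comment> \<open>\<open>z\<close> is the point of the interval from \<open>a\<close> to
        \<open>b\<close> nearest to \<open>y\<close>, so the rest \<open>y - z\<close> has absolute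
        value at most \<open>s\<close>.\<close>
      define z where "z = max a (min b y)"
      have "vector [t, z] \<in> K" using ab by (auto simp: z_def slice_def)
      moreover have "vector [0, y - z] \<in> S" using y ab s by (auto simp: S_def z_def)
      moreover have "vector [t, y] = vector [t, z] + (vector [0, y - z] :: real^2)"
        by (simp add: vec_eq_iff forall_2)
      ultimately show "y \<in> slice (K + S) t" by (auto simp: slice_def set_plus_iff)
    qed
    then show ?thesis
      using False ab s slice_nonempty_iff[of K t] by (simp flip: ennreal_plus)
  qed
  have "ennreal (measure lebesgue (K + S))
      = (\<integral>\<^sup>+ t. emeasure lborel (slice K t) + ennreal (2 * s) * indicator ?I t \<partial>lborel)"
    by (simp add: emeasure_slices(1)[OF KS] sl flip: emeasure_compact[OF KS])
  also have "\<dots> = emeasure lborel K + ennreal (2 * s) * emeasure lborel ?I"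
  proof -
    have [measurable]: "?I \<in> sets borel" using I by (simp add: borel_compact)
    have [measurable]: "(\<lambda>t. emeasure lborel (slice K t)) \<in> borel_measurable borel"
      using K(1) by (rule emeasure_slices(2))
    show ?thesis
      by (simp add: nn_integral_add nn_integral_cmult_indicator emeasure_slices(1)[OF K(1)])
  qed
  also have "\<dots> = ennreal (measure lebesgue K + 2 * s * measure lebesgue ?I)"
    using s by (simp add: emeasure_compact K I ennreal_mult' ennreal_plus)
  finally show ?thesis using s by (subst (asm) ennreal_inj) (auto simp: S_def)
qed

text \<open>For \<open>t\<close> in the common projection, the section of \<open>U + V\<close> at
  \<open>2 * t\<close> contains the sum of the two intervals at \<open>t\<close>, so its length is
  at least the sum of their lengths. The substitution of \<open>2 * t\<close> contributes the factor
  2.\<close>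

lemma measure_plus_ge_of_eq_projection:
  fixes U V :: "(real^2) set"
  assumes U: "compact U" "convex U" and V: "compact V" "convex V"
    and proj: "(\<lambda>x. x $ 1) ` U = (\<lambda>x. x $ 1) ` V"
  shows "2 * measure lebesgue U + 2 * measure lebesgue V \<le> measure lebesgue (U + V)"
proof -
  have UV: "compact (U + V)" by (rule compact_set_plus[OF U(1) V(1)])
  \<comment> \<open>The argument \<open>0 + 2 * t\<close> has the shape of the affine substitution
    \<open>nn_integral_real_affine\<close> below.\<close>
  have sl: "emeasure lborel (slice U t) + emeasure lborel (slice V t)
      \<le> emeasure lborel (slice (U + V) (0 + 2 * t))" for t
  proof (cases "slice U t = {}")
    case True
    then have "slice V t = {}" using proj slice_nonempty_iff by metis
    then show ?thesis using True by simp
  next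
    case False
    then obtain a b where ab: "a \<le> b" "slice U t = {a..b}" using slice_interval[OF U] by metis
    have "slice V t \<noteq> {}" using False proj slice_nonempty_iff by metis
    then obtain c d where cd: "c \<le> d" "slice V t = {c..d}" using slice_interval[OF V] by metis
    have "{a + c..b + d} \<subseteq> slice (U + V) (2 * t)"
    proof
      fix y assume y: "y \<in> {a + c..b + d}"
      \<comment> \<open>The part taken from the section of \<open>U\<close> is as large as possible
        while leaving at least \<open>c\<close> for the section of \<open>V\<close>.\<close>
      define z where "z = max a (min b (y - c))"
      have "vector [t, z] \<in> U" "vector [t, y - z] \<in> V"
        using ab cd y by (auto simp: z_def slice_def set_eq_iff)
      moreover have "vector [2 * t, y] = vector [t, z] + (vector [t, y - z] :: real^2)"
        by (simp add: vec_eq_iff forall_2)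
      ultimately show "y \<in> slice (U + V) (2 * t)" by (auto simp: slice_def set_plus_iff)
    qed
    then have "emeasure lborel {a + c..b + d} \<le> emeasure lborel (slice (U + V) (2 * t))"
      using compact_slice[OF UV] by (intro emeasure_mono) (auto simp: borel_compact)
    then show ?thesis using ab cd by (simp flip: ennreal_plus add: algebra_simps)
  qed
  have "ennreal (2 * measure lebesgue U + 2 * measure lebesgue V)
      = 2 * (emeasure lborel U + emeasure lborel V)"
    by (simp add: emeasure_compact U V distrib_left ennreal_mult' flip: ennreal_plus)
      (simp flip: ennreal_numeral ennreal_mult' ennreal_plus)
  also have "\<dots> = 2 * (\<integral>\<^sup>+ t. emeasure lborel (slice U t) + emeasure lborel (slice V t) \<partial>lborel)"
    using emeasure_slices[OF U(1)] emeasure_slices[OF V(1)] by (subst nn_integral_add) auto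
  also have "\<dots> \<le> 2 * (\<integral>\<^sup>+ t. emeasure lborel (slice (U + V) (0 + 2 * t)) \<partial>lborel)"
    by (intro mult_left_mono nn_integral_mono sl) simp
  also have "\<dots> = emeasure lborel (U + V)"
    using nn_integral_real_affine[OF emeasure_slices(2)[OF UV], of 2 0] emeasure_slices(1)[OF UV]
    by simp
  also have "\<dots> = ennreal (measure lebesgue (U + V))" by (rule emeasure_compact[OF UV])
  finally show ?thesis by (subst (asm) ennreal_le_iff) auto
qed

section \<open>Orthogonal change of coordinates\<close>

lemma linear_image_set_plus:
  assumes "linear f"
  shows "f ` (A + B) = f ` A + f ` B"
  by (force simp: set_plus_iff image_iff linear_add[OF assms])

text \<open>Turns an arbitrary direction \<open>f e\<close> into a coordinate direction
  \<open>e\<close>, so that the results on vertical sections apply in every direction.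
  \<open>f\<close> preserves inner products, hence projecting \<open>K'\<close> to \<open>e\<close>
  is the same as projecting \<open>K\<close> to \<open>f e\<close>.\<close>

lemma orthogonal_preimage:
  fixes f :: "real^2 \<Rightarrow> real^2" and K :: "(real^2) set"
  assumes f: "orthogonal_transformation f" and K: "compact K" "convex K"
  obtains K' where "compact K'" "convex K'" "K = f ` K'" "measure lebesgue K' = measure lebesgue K"
    "\<And>e. (\<lambda>x. x \<bullet> e) ` K' = (\<lambda>x. x \<bullet> f e) ` K"
proof -
  let ?g = "inv f"
  have g: "orthogonal_transformation ?g" using f by (rule orthogonal_transformation_inv)
  then have lin: "linear ?g" by (rule orthogonal_transformation_linear)
  have fg: "f (?g x) = x" for x
    by (simp add: f orthogonal_transformation_surj surj_f_inv_f)
  have c: "compact (?g ` K)"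
    by (intro compact_continuous_image linear_continuous_on K)
      (use lin in \<open>simp add: linear_conv_bounded_linear\<close>)
  have K': "K = f ` ?g ` K" by (simp add: image_image fg)
  have e: "?g x \<bullet> e = x \<bullet> f e" for x e
    using f fg[of x] unfolding orthogonal_transformation_def by metis
  show thesis
    by (rule that[OF c convex_linear_image[OF lin K(2)] K'])
      (use measure_orthogonal_image[OF g lmeasurable_compact[OF K(1)]] in \<open>auto simp: image_image e\<close>)
qed

subsection \<open>Support functions\<close>

lemma
  shows compact_body: "compact (body U)" and convex_body: "convex (body U)"
    and body_nonempty: "body U \<noteq> {}" and uminus_image_body: "uminus ` body U = body U"
  using body[of U] by auto

lemma uminus_in_body: "x \<in> body U \<Longrightarrow> - x \<in> body U"
  using uminus_image_body[of U] by (metis imageI)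

lemma zero_in_body: "0 \<in> body U"
proof -
  obtain x where "x \<in> body U" using body_nonempty[of U] by blast
  then show ?thesis
    using convexD[OF convex_body[of U], of x "- x" "1/2" "1/2"] uminus_in_body[of x U] by simp
qed

text \<open>The support function. By central symmetry its value at a unit vector \<open>u\<close> is
  half the width of \<open>U\<close> in direction \<open>u\<close>.\<close>

definition supp :: "sym_body \<Rightarrow> real^2 \<Rightarrow> real" where
  "supp U u = (SUP x\<in>body U. x \<bullet> u)"

lemma compact_inner_image_body: "compact ((\<lambda>x. x \<bullet> u) ` body U)"
  by (intro compact_continuous_image compact_body continuous_intros)

lemma supp_upper: "x \<in> body U \<Longrightarrow> x \<bullet> u \<le> supp U u"
  unfolding supp_def using compact_inner_image_body[of u U]
  by (intro cSUP_upper) (auto intro: bounded_imp_bdd_above compact_imp_bounded)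

lemma supp_attained: obtains x where "x \<in> body U" "supp U u = x \<bullet> u"
proof -
  have "continuous_on (body U) (\<lambda>x. x \<bullet> u)" by (intro continuous_intros)
  then obtain x where x: "x \<in> body U" "\<And>y. y \<in> body U \<Longrightarrow> y \<bullet> u \<le> x \<bullet> u"
    using continuous_attains_sup[OF compact_body[of U] body_nonempty, of "\<lambda>x. x \<bullet> u"] by blast
  have "supp U u = x \<bullet> u"
    unfolding supp_def by (rule cSup_eq_maximum) (use x in auto)
  then show thesis using x(1) that by blast
qed

lemma supp_eqI:
  assumes "x \<in> body U" "c = x \<bullet> u" "\<And>y. y \<in> body U \<Longrightarrow> y \<bullet> u \<le> c"
  shows "supp U u = c"
  by (metis assms order_antisym supp_attained supp_upper)

lemma supp_nonneg: "0 \<le> supp U u"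
  using supp_upper[OF zero_in_body] by simp

lemma supp_minus: "supp U (- u) = supp U u"
proof -
  have le: "supp U (- u) \<le> supp U u" for u
  proof -
    obtain x where "x \<in> body U" "supp U (- u) = x \<bullet> (- u)" by (rule supp_attained)
    then show ?thesis using supp_upper[OF uminus_in_body, of x U u] by simp
  qed
  from le[of u] le[of "- u"] show ?thesis by simp
qed

lemma supp_plus: "supp (U + V) u = supp U u + supp V u"
proof -
  obtain x where x: "x \<in> body U" "supp U u = x \<bullet> u" by (rule supp_attained)
  obtain y where y: "y \<in> body V" "supp V u = y \<bullet> u" by (rule supp_attained)
  show ?thesis
  proof (rule supp_eqI[of "x + y"])
    show "supp U u + supp V u = (x + y) \<bullet> u" by (simp only: x y inner_add_left)
    show "x + y \<in> body (U + V)" using x y by (auto simp: plus_sym_body.rep_eq)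
    show "z \<bullet> u \<le> supp U u + supp V u" if "z \<in> body (U + V)" for z
      using that by (auto simp: plus_sym_body.rep_eq set_plus_iff inner_add_left intro!: add_mono supp_upper)
  qed
qed

lemma supp_zero: "supp 0 u = 0"
  by (rule supp_eqI[of 0]) (auto simp: zero_sym_body.rep_eq)

lemma supp_sum: "supp (\<Sum>i\<in>I. W i) u = (\<Sum>i\<in>I. supp (W i) u)"
  by (induction I rule: infinite_finite_induct) (auto simp: supp_zero supp_plus)

lemma supp_scale_body:
  assumes "0 \<le> r"
  shows "supp (scale_body r U) u = r * supp U u"
proof -
  obtain x where x: "x \<in> body U" "supp U u = x \<bullet> u" by (rule supp_attained)
  show ?thesis
  proof (rule supp_eqI[of "r *\<^sub>R x"])
    show "r * supp U u = (r *\<^sub>R x) \<bullet> u" by (simp only: x inner_scaleR_left)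
    show "r *\<^sub>R x \<in> body (scale_body r U)" using x(1) by (auto simp: scale_body.rep_eq)
    show "z \<bullet> u \<le> r * supp U u" if "z \<in> body (scale_body r U)" for z
      using that assms by (auto simp: scale_body.rep_eq intro!: mult_left_mono supp_upper)
  qed
qed

lemma supp_unit_disc: "supp unit_disc u = norm u"
proof (cases "u = 0")
  case True
  then show ?thesis by (auto intro: supp_eqI[of 0] simp: unit_disc.rep_eq)
next
  case False
  show ?thesis
  proof (rule supp_eqI[of "u /\<^sub>R norm u"])
    show "norm u = (u /\<^sub>R norm u) \<bullet> u"
      using False by (simp add: power2_norm_eq_inner[symmetric] power2_eq_square)
    fix y assume "y \<in> body unit_disc"
    then have "norm y \<le> 1" by (simp add: unit_disc.rep_eq)
    then show "y \<bullet> u \<le> norm u"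
      using norm_cauchy_schwarz[of y u] mult_right_mono[of "norm y" 1 "norm u"] by simp
  qed (simp add: unit_disc.rep_eq False)
qed

text \<open>A point outside the compact convex set is strictly separated from it by a hyperplane;
  the normal \<open>- a\<close> pointing away from the body then violates the inequality.\<close>

lemma in_body_iff: "z \<in> body V \<longleftrightarrow> (\<forall>u. z \<bullet> u \<le> supp V u)"
proof
  assume le: "\<forall>u. z \<bullet> u \<le> supp V u"
  show "z \<in> body V"
  proof (rule ccontr)
    assume z: "z \<notin> body V"
    obtain a b where ab: "a \<bullet> z < b" "\<And>x. x \<in> body V \<Longrightarrow> b < a \<bullet> x"
      using separating_hyperplane_closed_point[OF convex_body[of V] compact_imp_closed[OF compact_body] z]
      by blast
    obtain x where "x \<in> body V" "supp V (- a) = x \<bullet> (- a)" by (rule supp_attained)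
    then show False
      using ab(1) ab(2)[of x] le[rule_format, of "- a"] by (simp add: inner_commute)
  qed
qed (simp add: supp_upper)

lemma body_subset_iff: "body U \<subseteq> body V \<longleftrightarrow> (\<forall>u. supp U u \<le> supp V u)"
proof
  assume "body U \<subseteq> body V"
  then show "\<forall>u. supp U u \<le> supp V u" by (metis subsetD supp_attained supp_upper)
next
  assume "\<forall>u. supp U u \<le> supp V u"
  then show "body U \<subseteq> body V" by (meson in_body_iff order_trans subsetI)
qed

text \<open>A compact connected set of reals is an interval, and symmetry makes its ends opposite.
  Hence equal values of the support functions mean equal projections, with no translation
  involved.\<close>

lemma inner_image_body: "(\<lambda>x. x \<bullet> u) ` body U = {- supp U u..supp U u}"
proof -
  have "connected ((\<lambda>x. x \<bullet> u) ` body U)"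
    by (intro connected_continuous_image convex_connected convex_body continuous_intros)
  then obtain a b where ab: "(\<lambda>x. x \<bullet> u) ` body U = {a..b}"
    using compact_inner_image_body[of u U]
      connected_compact_interval_1[of "(\<lambda>x. x \<bullet> u) ` body U"] by blast
  have le: "\<bar>x \<bullet> u\<bar> \<le> supp U u" if "x \<in> body U" for x
    using supp_upper[OF that, of u] supp_upper[OF uminus_in_body[OF that], of u] by simp
  obtain x where x: "x \<in> body U" "supp U u = x \<bullet> u" by (rule supp_attained)
  have "supp U u \<in> {a..b}" "- supp U u \<in> {a..b}"
    unfolding ab[symmetric] using x(2) imageI[OF x(1), of "\<lambda>x. x \<bullet> u"]
      imageI[OF uminus_in_body[OF x(1)], of "\<lambda>x. x \<bullet> u"] by simp_all
  moreover have "{a..b} \<subseteq> {- supp U u..supp U u}"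
    unfolding ab[symmetric] using le by (force simp: abs_le_iff)
  ultimately show ?thesis unfolding ab by auto
qed

section \<open>Segments and the area of sums\<close>

lift_definition segment_body :: "real^2 \<Rightarrow> sym_body" is "\<lambda>v. closed_segment (- v) v"
proof -
  fix v :: "real^2"
  have "uminus ` closed_segment (- v) v = closed_segment (- v) v"
    using closed_segment_linear_image[of uminus "- v" v]
    by (simp add: linear_iff closed_segment_commute)
  then show "closed_segment (- v) v \<noteq> {} \<and> compact (closed_segment (- v) v) \<and>
      convex (closed_segment (- v) v) \<and> closed_segment (- v) v = uminus ` closed_segment (- v) v"
    by simp
qed

lemma segment_body_iff: "x \<in> body (segment_body v) \<longleftrightarrow> (\<exists>c. \<bar>c\<bar> \<le> 1 \<and> x = c *\<^sub>R v)"
proof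
  assume "x \<in> body (segment_body v)"
  then obtain t where "0 \<le> t" "t \<le> 1" "x = (1 - t) *\<^sub>R (- v) + t *\<^sub>R v"
    by (auto simp: segment_body.rep_eq in_segment)
  then show "\<exists>c. \<bar>c\<bar> \<le> 1 \<and> x = c *\<^sub>R v"
    by (intro exI[of _ "2 * t - 1"]) (auto simp: algebra_simps scaleR_2[symmetric])
next
  assume "\<exists>c. \<bar>c\<bar> \<le> 1 \<and> x = c *\<^sub>R v"
  then obtain c where "\<bar>c\<bar> \<le> 1" "x = c *\<^sub>R v" by blast
  then show "x \<in> body (segment_body v)"
    unfolding segment_body.rep_eq in_segment
    by (intro exI[of _ "(1 + c) / 2"]) (auto simp: vec_eq_iff field_simps)
qed

lemma supp_segment_body: "supp (segment_body v) u = \<bar>v \<bullet> u\<bar>"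
proof (rule supp_eqI[of "sgn (v \<bullet> u) *\<^sub>R v"])
  show "sgn (v \<bullet> u) *\<^sub>R v \<in> body (segment_body v)"
    by (auto simp: segment_body_iff abs_sgn_eq intro!: exI[of _ "sgn (v \<bullet> u)"])
  fix y assume "y \<in> body (segment_body v)"
  then obtain c where "\<bar>c\<bar> \<le> 1" "y = c *\<^sub>R v" by (auto simp: segment_body_iff)
  then show "y \<bullet> u \<le> \<bar>v \<bullet> u\<bar>"
    using abs_le_D1[of "c * (v \<bullet> u)"] mult_right_mono[of "\<bar>c\<bar>" 1 "\<bar>v \<bullet> u\<bar>"] by (simp add: abs_mult)
qed (simp add: abs_sgn mult.commute)

text \<open>After rotating \<open>v\<close> to the vertical axis this is the formula for vertical
  segments, with \<open>c = 4 * norm v\<close> and \<open>u\<close> a unit vector orthogonal to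
  \<open>v\<close>. Both depend on \<open>v\<close> only, so the gain in area is additive in
  \<open>K\<close>.\<close>

lemma body_area_plus_segment:
  obtains c u where "\<And>K. body_area (K + segment_body v) = body_area K + c * supp K u"
proof -
  let ?e1 = "axis 1 1 :: real^2" and ?e2 = "axis 2 (norm v) :: real^2"
  \<comment> \<open>The vector \<open>axis 2 (norm v)\<close> has the norm of \<open>v\<close>, so
    an orthogonal map carries it to \<open>v\<close>, even for \<open>v = 0\<close>.\<close>
  obtain f where f: "orthogonal_transformation f" "f ?e2 = v"
    using orthogonal_transformation_exists[of ?e2 v]
    by (auto simp: norm_eq_sqrt_inner[of "axis _ _"] inner_axis_axis)
  have lin: "linear f" using f by (simp add: orthogonal_transformation_linear)
  let ?S = "{x :: real^2. x $ 1 = 0 \<and> \<bar>x $ 2\<bar> \<le> norm v}"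
  have S: "body (segment_body v) = f ` ?S"
  proof -
    have "?S = {c *\<^sub>R ?e2 | c. \<bar>c\<bar> \<le> 1}"
    proof (intro set_eqI iffI)
      fix x assume x: "x \<in> ?S"
      show "x \<in> {c *\<^sub>R ?e2 | c. \<bar>c\<bar> \<le> 1}"
      proof (cases "v = 0")
        case True
        then have "norm v = 0" by simp
        then have "x = 0" using x by (auto simp: vec_eq_iff[of x] forall_2)
        then show ?thesis by (auto intro!: exI[of _ 0])
      next
        case False
        then show ?thesis
          using x by (auto intro!: exI[of _ "x $ 2 / norm v"] simp: vec_eq_iff forall_2 axis_def)
      qed
    next
      fix x assume "x \<in> {c *\<^sub>R ?e2 | c. \<bar>c\<bar> \<le> 1}"
      then show "x \<in> ?S" by (auto simp: axis_def abs_mult mult_left_le_one_le)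
    qed
    then have "f ` ?S = {c *\<^sub>R v | c. \<bar>c\<bar> \<le> 1}"
      using f(2) by (auto simp: image_iff linear_scale[OF lin]) (metis linear_scale[OF lin])
    then show ?thesis by (auto simp: segment_body_iff)
  qed
  have "body_area (K + segment_body v) = body_area K + (4 * norm v) * supp K (f ?e1)" for K
  proof -
    obtain K' where K': "compact K'" "convex K'" "body K = f ` K'"
      "measure lebesgue K' = measure lebesgue (body K)"
      "\<And>e. (\<lambda>x. x \<bullet> e) ` K' = (\<lambda>x. x \<bullet> f e) ` body K"
      using orthogonal_preimage[OF f(1) compact_body convex_body] by metis
    have "compact ?S"
    proof -
      have "?S = cbox (vector [0, - norm v]) (vector [0, norm v])"
        by (auto simp: mem_box_cart forall_2)
      then show ?thesis by simp
    qed
    then have KS: "compact (K' + ?S)" using compact_set_plus[OF K'(1)] by simp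
    have "body (K + segment_body v) = f ` (K' + ?S)"
      by (simp add: plus_sym_body.rep_eq K'(3) S linear_image_set_plus[OF lin])
    then have "body_area (K + segment_body v) = measure lebesgue (K' + ?S)"
      using measure_orthogonal_image[OF f(1) lmeasurable_compact[OF KS]] by (simp add: body_area_def)
    also have "\<dots> = body_area K + 2 * norm v * measure lebesgue ((\<lambda>x. x $ 1) ` K')"
      by (subst measure_plus_vertical_segment) (simp_all add: K' body_area_def)
    also have "(\<lambda>x. x $ 1) ` K' = {- supp K (f ?e1)..supp K (f ?e1)}"
      using K'(5)[of ?e1] by (simp add: inner_axis inner_image_body)
    also have "measure lebesgue \<dots> = 2 * supp K (f ?e1)"
      using supp_nonneg[of K] by simp
    finally show ?thesis by simp
  qed
  then show thesis by (rule that)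
qed

text \<open>Rotating \<open>u\<close> to the first axis makes the projections to that axis the same
  interval, and the inequality for equal projections applies.\<close>

lemma body_area_plus_ge_of_eq_supp:
  assumes u: "norm u = 1" and eq: "supp U u = supp V u"
  shows "2 * body_area U + 2 * body_area V \<le> body_area (U + V)"
proof -
  let ?e1 = "axis 1 1 :: real^2"
  obtain f where f: "orthogonal_transformation f" "f ?e1 = u"
    using orthogonal_transformation_exists[of ?e1 u] u by (auto simp: norm_axis_1)
  have lin: "linear f" using f by (simp add: orthogonal_transformation_linear)
  obtain U' where U': "compact U'" "convex U'" "body U = f ` U'"
    "measure lebesgue U' = measure lebesgue (body U)"
    "\<And>e. (\<lambda>x. x \<bullet> e) ` U' = (\<lambda>x. x \<bullet> f e) ` body U"
    using orthogonal_preimage[OF f(1) compact_body convex_body] by metis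
  obtain V' where V': "compact V'" "convex V'" "body V = f ` V'"
    "measure lebesgue V' = measure lebesgue (body V)"
    "\<And>e. (\<lambda>x. x \<bullet> e) ` V' = (\<lambda>x. x \<bullet> f e) ` body V"
    using orthogonal_preimage[OF f(1) compact_body convex_body] by metis
  have "(\<lambda>x. x $ 1) ` U' = (\<lambda>x. x $ 1) ` V'"
    using U'(5)[of ?e1] V'(5)[of ?e1] f(2) eq by (simp add: inner_axis inner_image_body)
  then have "2 * measure lebesgue U' + 2 * measure lebesgue V' \<le> measure lebesgue (U' + V')"
    by (intro measure_plus_ge_of_eq_projection U' V')
  moreover have "body (U + V) = f ` (U' + V')"
    by (simp add: plus_sym_body.rep_eq U'(3) V'(3) linear_image_set_plus[OF lin])
  moreover have "compact (U' + V')" by (rule compact_set_plus[OF U'(1) V'(1)])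
  ultimately show ?thesis
    using measure_orthogonal_image[OF f(1) lmeasurable_compact, of "U' + V'"]
    by (simp add: body_area_def U'(4) V'(4))
qed

subsection \<open>Approximation by zonotopes\<close>

text \<open>The first hypothesis excludes interior dips: the sequence rises and then falls, so its
  total variation is controlled by its maximum and its end values.\<close>

lemma sum_abs_diff_unimodal_le:
  fixes c :: "nat \<Rightarrow> real"
  assumes "\<And>i j k. i < j \<Longrightarrow> j < k \<Longrightarrow> k \<le> n \<Longrightarrow> min (c i) (c k) \<le> c j"
    and "\<And>i. i \<le> n \<Longrightarrow> c i \<le> C"
  shows "(\<Sum>i<n. \<bar>c (Suc i) - c i\<bar>) \<le> 2 * C - c 0 - c n"
  using assms
proof (induction n arbitrary: C)
  case 0
  then show ?case by force
next
  case (Suc n)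
  have uni: "min (c i) (c k) \<le> c j" if "i < j" "j < k" "k \<le> n" for i j k
    using Suc.prems(1) that by simp
  show ?case
  proof (cases "c (Suc n) \<le> c n")
    case True
    have "(\<Sum>i<n. \<bar>c (Suc i) - c i\<bar>) \<le> 2 * C - c 0 - c n"
      using Suc.IH[OF uni, of C] Suc.prems(2) by simp
    then show ?thesis using True by simp
  next
    \<comment> \<open>If the last step rises, \<open>c n\<close> bounds all earlier values, and the
      induction hypothesis is used with \<open>c n\<close> in place of \<open>C\<close>.\<close>
    case False
    have "c i \<le> c n" if "i \<le> n" for i
      using False that Suc.prems(1)[of i n "Suc n"] by (cases "i = n") auto
    then have "(\<Sum>i<n. \<bar>c (Suc i) - c i\<bar>) \<le> 2 * c n - c 0 - c n"
      using Suc.IH[OF uni, of "c n"] by simp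
    then show ?thesis using False Suc.prems(2)[of "Suc n"] by simp
  qed
qed

text \<open>The triangle inequality on the stretches from 0 to \<open>k\<close> and from
  \<open>k\<close> to \<open>n\<close>. With the previous bound it determines the variation of a
  unimodal sequence.\<close>

lemma sum_abs_diff_ge:
  fixes c :: "nat \<Rightarrow> real"
  assumes "k \<le> n"
  shows "2 * c k - c 0 - c n \<le> (\<Sum>i<n. \<bar>c (Suc i) - c i\<bar>)"
proof -
  have le: "\<bar>c b - c a\<bar> \<le> (\<Sum>i=a..<b. \<bar>c (Suc i) - c i\<bar>)" if "a \<le> b" for a b
    using sum_abs[of "\<lambda>i. c (Suc i) - c i" "{a..<b}"] sum_Suc_diff'[OF that, of c] by simp
  have "(\<Sum>i<n. \<bar>c (Suc i) - c i\<bar>)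
      = (\<Sum>i=0..<k. \<bar>c (Suc i) - c i\<bar>) + (\<Sum>i=k..<n. \<bar>c (Suc i) - c i\<bar>)"
    using assms by (simp add: sum.atLeastLessThan_concat lessThan_atLeast0)
  then show ?thesis using le[of 0 k] le[OF assms] by linarith
qed

text \<open>A subtraction-free form of the additivity of the map sending \<open>U\<close> to
  \<open>body_area (U + W) - body_area U - body_area W\<close>, which is twice the mixed area with
  \<open>W\<close>.\<close>

definition area_additive :: "sym_body \<Rightarrow> bool" where
  "area_additive W \<longleftrightarrow> (\<forall>U V. body_area (U + V + W) + body_area U + body_area V + body_area W
    = body_area (U + V) + body_area (U + W) + body_area (V + W))"

lemma body_area_zero: "body_area 0 = 0"
  by (simp add: body_area_def zero_sym_body.rep_eq)

text \<open>The gain in area \<open>c * supp K u\<close> is additive in \<open>K\<close>; taking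
  \<open>K = 0\<close> shows that the segment itself has area 0.\<close>

lemma area_additive_segment: "area_additive (segment_body v)"
proof -
  obtain c u where cu: "\<And>K. body_area (K + segment_body v) = body_area K + c * supp K u"
    using body_area_plus_segment[of v] by metis
  have "body_area (segment_body v) = 0"
    using cu[of 0] by (simp add: body_area_zero supp_zero)
  then show ?thesis by (simp add: area_additive_def cu supp_plus distrib_left)
qed

lemma area_additive_plus:
  assumes "area_additive W" "area_additive W'"
  shows "area_additive (W + W')"
  unfolding area_additive_def
proof (intro allI)
  fix U V
  \<comment> \<open>The claim is the sum of the first two identities minus the third.\<close>
  have "body_area (U + W + V + W') + body_area (U + W) + body_area V + body_area W'
      = body_area (U + W + V) + body_area (U + W + W') + body_area (V + W')"
    "body_area (U + V + W) + body_area U + body_area V + body_area W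
      = body_area (U + V) + body_area (U + W) + body_area (V + W)"
    "body_area (V + W + W') + body_area V + body_area W + body_area W'
      = body_area (V + W) + body_area (V + W') + body_area (W + W')"
    using assms unfolding area_additive_def by blast+
  then show "body_area (U + V + (W + W')) + body_area U + body_area V + body_area (W + W')
      = body_area (U + V) + body_area (U + (W + W')) + body_area (V + (W + W'))"
    by (simp add: ac_simps)
qed

lemma area_additive_zero: "area_additive 0"
  by (simp add: area_additive_def body_area_zero)

lemma area_additive_sum:
  "(\<And>i. i \<in> I \<Longrightarrow> area_additive (W i)) \<Longrightarrow> area_additive (\<Sum>i\<in>I. W i)"
  by (induction I rule: infinite_finite_induct) (auto simp: area_additive_zero area_additive_plus)

lemma inner_real2: "(x :: real^2) \<bullet> y = x $ 1 * y $ 1 + x $ 2 * y $ 2"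
  by (simp add: inner_vec_def sum_2)

text \<open>The zonotope \<open>Z\<close> is generated by the halved edges of the polygonal line through the upper
  boundary points \<open>p 0, \<dots>, p n\<close> of \<open>W\<close> above the (symmetric) set \<open>X\<close> of abscissae, together with
  the halved vertical edge from \<open>p n\<close> to \<open>- p 0\<close>. Its support function is half the total variation
  of \<open>p i \<bullet> u\<close> along this half of the boundary; since the sequence is unimodal by concavity of the
  upper boundary, this is the maximum of \<open>p i \<bullet> u\<close>.\<close>

lemma inner_approximation:
  assumes F: "finite F" "F \<subseteq> body W"
  obtains Z where "area_additive Z" "F \<subseteq> body Z" "body Z \<subseteq> body W"
proof -
  let ?e1 = "axis 1 1 :: real^2"
  define a where "a = supp W ?e1"
  \<comment> \<open>With \<open>F\<close> symmetrized, directions with \<open>u $ 2 < 0\<close>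
    reduce to the others by passing to \<open>- q\<close> and \<open>- u\<close>. The abscissae
    \<open>- a\<close> and \<open>a\<close> make the polygonal line run from one end of
    \<open>W\<close> to the other.\<close>
  define F' where "F' = F \<union> uminus ` F"
  define X where "X = (\<lambda>x. x $ 1) ` F' \<union> {- a, a}"
  have proj: "(\<lambda>x. x $ 1) ` body W = {- a..a}"
    using inner_image_body[of ?e1 W] by (simp add: inner_axis a_def)
  have a: "0 \<le> a" by (simp add: a_def supp_nonneg)
  have F': "F' \<subseteq> body W" "finite F'" using F uminus_in_body by (auto simp: F'_def)
  have X: "finite X" "X \<subseteq> {- a..a}" "- a \<in> X" "a \<in> X"
    using F' a proj by (auto simp: X_def)
  define g where "g t = Sup (slice (body W) t)" for t
  have gW: "vector [t, g t] \<in> body W" and g_upper: "\<And>x. x \<in> body W \<Longrightarrow> x $ 1 = t \<Longrightarrow> x $ 2 \<le> g t"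
    if t: "t \<in> X" for t
  proof -
    have "slice (body W) t \<noteq> {}" using t X(2) proj slice_nonempty_iff[of "body W" t] by blast
    then obtain c d where cd: "c \<le> d" "slice (body W) t = {c..d}"
      using slice_interval[OF compact_body convex_body] by metis
    then have g: "g t = d" by (simp add: g_def)
    then have "g t \<in> slice (body W) t" using cd by simp
    then show "vector [t, g t] \<in> body W" by (simp add: slice_def)
    fix x assume "x \<in> body W" "x $ 1 = t"
    then show "x $ 2 \<le> g t" using slice_iff[of x "body W"] cd g by simp
  qed
  define xs where "xs = sorted_list_of_set X"
  define n where "n = length xs - 1"
  have xs: "set xs = X" "sorted_wrt (<) xs" using X(1) by (simp_all add: xs_def)
  have len: "length xs = Suc n" using X(3) xs(1) by (cases xs) (auto simp: n_def)
  define p where "p i = (vector [xs ! i, g (xs ! i)] :: real^2)" for i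
  have xsX: "xs ! i \<in> X" if "i \<le> n" for i using that len xs(1) nth_mem[of i xs] by simp
  have pW: "p i \<in> body W" if "i \<le> n" for i using gW[OF xsX[OF that]] by (simp add: p_def)
  have x_less: "xs ! i < xs ! j" if "i < j" "j \<le> n" for i j
    using sorted_wrt_nth_less[OF xs(2), of i j] that len by simp
  have idx: "\<exists>i\<le>n. t = xs ! i" if "t \<in> X" for t
    using that len by (auto simp: in_set_conv_nth less_Suc_eq_le simp flip: xs(1))
  have x0: "xs ! 0 = - a"
  proof -
    obtain i where "i \<le> n" "- a = xs ! i" using idx[OF X(3)] by blast
    then show ?thesis using x_less[of 0 i] X(2) xsX[of 0] by (cases "i = 0") auto
  qed
  have xn: "xs ! n = a"
  proof -
    obtain i where "i \<le> n" "a = xs ! i" using idx[OF X(4)] by blast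
    then show ?thesis using x_less[of i n] X(2) xsX[of n] by (cases "i = n") auto
  qed
  \<comment> \<open>\<open>- p 0\<close> lies in \<open>W\<close> at the same abscissa
    \<open>a\<close> as \<open>p n\<close>, and not higher. So for \<open>0 \<le> u $ 2\<close> the
    closing edge enters \<open>supp Z u\<close> without an absolute value.\<close>
  have pn0: "(p n + p 0) $ 1 = 0" "0 \<le> (p n + p 0) $ 2"
  proof -
    show "(p n + p 0) $ 1 = 0" by (simp add: p_def x0 xn)
    have "- p 0 \<in> body W" using pW uminus_in_body by simp
    moreover have "(- p 0) $ 1 = a" by (simp add: p_def x0)
    ultimately have "(- p 0) $ 2 \<le> g a" using g_upper X(4) by blast
    then show "0 \<le> (p n + p 0) $ 2" by (simp add: p_def x0 xn)
  qed
  define Z where "Z = (\<Sum>i<n. segment_body ((1/2) *\<^sub>R (p (Suc i) - p i)))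
    + segment_body ((1/2) *\<^sub>R (p n + p 0))"
  have suppZ: "supp Z u = ((\<Sum>i<n. \<bar>p (Suc i) \<bullet> u - p i \<bullet> u\<bar>) + (p n \<bullet> u + p 0 \<bullet> u)) / 2"
    if "0 \<le> u $ 2" for u
  proof -
    have "(p n + p 0) \<bullet> u = (p n + p 0) $ 2 * u $ 2"
      using pn0(1) by (simp only: inner_real2)
    then have "\<bar>(p n + p 0) \<bullet> u\<bar> = p n \<bullet> u + p 0 \<bullet> u"
      using pn0(2) that by (simp add: inner_add_left)
    then show ?thesis
      by (simp add: Z_def supp_plus supp_sum supp_segment_body inner_diff_left abs_mult
          sum_divide_distrib add_divide_distrib)
  qed
  have F'Z: "q \<bullet> u \<le> supp Z u" if q: "q \<in> F'" and u: "0 \<le> u $ 2" for q u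
  proof -
    have "q $ 1 \<in> X" using q by (auto simp: X_def)
    then obtain i where i: "i \<le> n" "q $ 1 = xs ! i" using idx by blast
    have "q $ 2 \<le> g (q $ 1)" using g_upper[OF \<open>q $ 1 \<in> X\<close>] q F' by blast
    then have "q \<bullet> u \<le> p i \<bullet> u"
      using u i by (simp add: inner_real2 p_def mult_right_mono)
    also have "\<dots> \<le> supp Z u"
      using sum_abs_diff_ge[OF i(1), of "\<lambda>i. p i \<bullet> u"] suppZ[OF u] by simp
    finally show ?thesis .
  qed
  have ZW: "supp Z u \<le> supp W u" if u: "0 \<le> u $ 2" for u
  proof -
    have "min (p i \<bullet> u) (p k \<bullet> u) \<le> p j \<bullet> u" if ijk: "i < j" "j < k" "k \<le> n" for i j k
    proof -
      \<comment> \<open>\<open>l\<close> is the weight for which the point \<open>r\<close> of the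
        chord from \<open>p i\<close> to \<open>p k\<close> has abscissa \<open>xs ! j\<close>; as
        \<open>r\<close> lies in \<open>W\<close>, it is not above \<open>p j\<close>.\<close>
      define l where "l = (xs ! k - xs ! j) / (xs ! k - xs ! i)"
      have less: "xs ! i < xs ! j" "xs ! j < xs ! k" using x_less ijk by simp_all
      then have l: "0 \<le> l" "l \<le> 1" by (simp_all add: l_def)
      define r where "r = l *\<^sub>R p i + (1 - l) *\<^sub>R p k"
      have "r \<in> body W"
        unfolding r_def using pW ijk l by (intro convexD[OF convex_body]) auto
      moreover have "r $ 1 = xs ! j"
      proof -
        have "l * (xs ! k - xs ! i) = xs ! k - xs ! j" using less by (simp add: l_def)
        then show ?thesis by (simp add: r_def p_def algebra_simps)
      qed
      ultimately have "r $ 2 \<le> g (xs ! j)" "r $ 1 = xs ! j" using g_upper xsX ijk by auto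
      then have "r \<bullet> u \<le> p j \<bullet> u"
        using u by (simp add: inner_real2 p_def mult_right_mono)
      moreover have "min (p i \<bullet> u) (p k \<bullet> u) \<le> r \<bullet> u"
      proof -
        let ?m = "min (p i \<bullet> u) (p k \<bullet> u)"
        have "l * ?m + (1 - l) * ?m \<le> l * (p i \<bullet> u) + (1 - l) * (p k \<bullet> u)"
          using l by (intro add_mono mult_left_mono) auto
        then show ?thesis by (simp add: r_def inner_add_left algebra_simps)
      qed
      ultimately show ?thesis by linarith
    qed
    then have "(\<Sum>i<n. \<bar>p (Suc i) \<bullet> u - p i \<bullet> u\<bar>) \<le> 2 * supp W u - p 0 \<bullet> u - p n \<bullet> u"
      using pW supp_upper by (intro sum_abs_diff_unimodal_le[where c = "\<lambda>i. p i \<bullet> u"]) auto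
    then show ?thesis using suppZ[OF u] by simp
  qed
  show thesis
  proof (rule that[of Z])
    show "area_additive Z"
      unfolding Z_def by (intro area_additive_plus area_additive_sum area_additive_segment)
    show "body Z \<subseteq> body W"
      unfolding body_subset_iff
    proof
      fix u :: "real^2"
      show "supp Z u \<le> supp W u"
        using ZW[of u] ZW[of "- u"] by (cases "0 \<le> u $ 2") (simp_all add: supp_minus)
    qed
    show "F \<subseteq> body Z"
    proof
      fix q assume q: "q \<in> F"
      have "q \<bullet> u \<le> supp Z u" for u
      proof (cases "0 \<le> u $ 2")
        case True
        then show ?thesis using F'Z[of q u] q by (simp add: F'_def)
      next
        case False
        then show ?thesis using F'Z[of "- q" "- u"] q by (simp add: F'_def supp_minus)
      qed
      then show "q \<in> body Z" by (simp add: in_body_iff)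
    qed
  qed
qed

section \<open>Passage to the limit\<close>

lemma body_area_mono: "body U \<subseteq> body V \<Longrightarrow> body_area U \<le> body_area V"
  unfolding body_area_def
  by (intro measure_mono_fmeasurable) (auto simp: compact_body lmeasurable_compact intro: fmeasurableD)

text \<open>Take a zonotope inside \<open>W\<close> containing a finite \<open>r\<close>-net of
  \<open>W\<close>, and add the square \<open>Q\<close> of half side \<open>r\<close>.
  \<open>Q\<close> contains the disc of radius \<open>r\<close>, so the sum covers \<open>W\<close>;
  it lies in the disc of radius \<open>2 * r = d\<close>, so the sum stays within \<open>d\<close>
  of \<open>W\<close>.\<close>

lemma outer_approximation:
  assumes "0 < d"
  obtains Z where "area_additive Z" "body W \<subseteq> body Z" "\<And>z. z \<in> body Z \<Longrightarrow> \<exists>w\<in>body W. dist w z \<le> d"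
proof -
  define r where "r = d / 2"
  have r: "0 < r" "r + r = d" using assms by (simp_all add: r_def)
  have "seq_compact (body W)" using compact_body compact_imp_seq_compact by blast
  then obtain F where F: "finite F" "F \<subseteq> body W" "body W \<subseteq> (\<Union>x\<in>F. ball x r)"
    using seq_compact_imp_totally_bounded r(1) by metis
  obtain Z where Z: "area_additive Z" "F \<subseteq> body Z" "body Z \<subseteq> body W"
    using inner_approximation[OF F(1,2)] .
  define Q where "Q = segment_body (axis 1 r) + segment_body (axis 2 r)"
  have Q: "y \<in> body Q" if "norm y \<le> r" for y
  proof -
    have "\<bar>y $ 1 / r\<bar> \<le> 1" "\<bar>y $ 2 / r\<bar> \<le> 1"
      using that r(1) component_le_norm_cart[of y 1] component_le_norm_cart[of y 2] by simp_all
    then have "(y $ 1 / r) *\<^sub>R axis 1 r \<in> body (segment_body (axis 1 r))"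
      "(y $ 2 / r) *\<^sub>R axis 2 r \<in> body (segment_body (axis 2 r))"
      unfolding segment_body_iff by blast+
    moreover have "y = (y $ 1 / r) *\<^sub>R axis 1 r + (y $ 2 / r) *\<^sub>R axis 2 r"
      using r(1) by (simp add: vec_eq_iff forall_2 axis_def)
    ultimately show ?thesis unfolding Q_def plus_sym_body.rep_eq set_plus_iff by blast
  qed
  have Q_norm: "norm q \<le> d" if q: "q \<in> body Q" for q
  proof -
    obtain x y where xy: "q = x + y" "x \<in> body (segment_body (axis 1 r))" "y \<in> body (segment_body (axis 2 r))"
      using q by (auto simp: Q_def plus_sym_body.rep_eq set_plus_iff)
    then obtain b c where "\<bar>b\<bar> \<le> 1" "x = b *\<^sub>R axis 1 r" "\<bar>c\<bar> \<le> 1" "y = c *\<^sub>R axis 2 r"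
      by (auto simp: segment_body_iff)
    moreover have "norm (axis k r :: real^2) = r" for k
      using r(1) by (simp add: norm_eq_sqrt_inner inner_axis_axis)
    ultimately have "norm x \<le> r" "norm y \<le> r"
      using r(1) by (simp_all add: mult_left_le_one_le)
    then show ?thesis using norm_triangle_ineq[of x y] r(2) xy(1) by simp
  qed
  show thesis
  proof (rule that[of "Z + Q"])
    show "area_additive (Z + Q)"
      unfolding Q_def by (intro area_additive_plus Z area_additive_segment)
    show "body W \<subseteq> body (Z + Q)"
    proof
      fix w assume "w \<in> body W"
      then obtain x where x: "x \<in> F" "dist x w < r" using F(3) by auto
      then have "w - x \<in> body Q" by (intro Q) (simp add: dist_norm norm_minus_commute)
      moreover have "w = x + (w - x)" by simp
      ultimately show "w \<in> body (Z + Q)"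
        using x(1) Z(2) unfolding plus_sym_body.rep_eq set_plus_iff by blast
    qed
    fix z assume "z \<in> body (Z + Q)"
    then obtain x q where "x \<in> body Z" "q \<in> body Q" "z = x + q"
      by (auto simp: plus_sym_body.rep_eq set_plus_iff)
    then show "\<exists>w\<in>body W. dist w z \<le> d"
      using Z(3) Q_norm[of q] by (intro bexI[of _ x]) (auto simp: dist_norm)
  qed
qed

text \<open>Area is upper semicontinuous at \<open>K + W\<close> because the frontier of a convex
  set is negligible. Adding \<open>K\<close> preserves closeness: \<open>k + w\<close> is as far
  from \<open>k + z\<close> as \<open>w\<close> is from \<open>z\<close>.\<close>

lemma body_area_semicontinuous:
  assumes "0 < e"
  obtains d where "0 < d"
    "\<And>Z. (\<And>z. z \<in> body Z \<Longrightarrow> \<exists>w\<in>body W. dist w z < d) \<Longrightarrow> body_area (K + Z) < body_area (K + W) + e"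
proof -
  obtain d where d: "d > 0" "\<And>T. \<lbrakk>T \<in> lmeasurable; \<And>y. y \<in> T \<Longrightarrow> \<exists>x. x \<in> body (K + W) \<and> dist x y < d\<rbrakk>
      \<Longrightarrow> measure lebesgue T < measure lebesgue (body (K + W)) + e"
    using measure_semicontinuous_with_hausdist_explicit[of "body (K + W)" e]
      compact_imp_bounded[OF compact_body] negligible_convex_frontier[OF convex_body] assms by metis
  show thesis
  proof (rule that[OF d(1)])
    fix Z assume Z: "\<And>z. z \<in> body Z \<Longrightarrow> \<exists>w\<in>body W. dist w z < d"
    show "body_area (K + Z) < body_area (K + W) + e"
      unfolding body_area_def
    proof (rule d(2))
      show "body (K + Z) \<in> lmeasurable" by (simp add: compact_body lmeasurable_compact)
      fix y assume "y \<in> body (K + Z)"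
      then obtain k z where kz: "k \<in> body K" "z \<in> body Z" "y = k + z"
        by (auto simp: plus_sym_body.rep_eq set_plus_iff)
      then obtain w where "w \<in> body W" "dist w z < d" using Z by blast
      then show "\<exists>x. x \<in> body (K + W) \<and> dist x y < d"
        using kz by (intro exI[of _ "k + w"]) (auto simp: plus_sym_body.rep_eq)
    qed
  qed
qed

lemma area_additive_all: "area_additive W"
  unfolding area_additive_def
proof (intro allI)
  fix U V
  \<comment> \<open>The defect \<open>?D\<close> vanishes at an outer approximation \<open>Z\<close>
    of \<open>W\<close>. Passing from \<open>W\<close> to \<open>Z\<close> raises each of the four
    areas involving \<open>W\<close> by less than \<open>e / 2\<close> and lowers none; two of them
    enter with each sign, so the defect at \<open>W\<close> is at most \<open>e\<close> in absolute
    value.\<close>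
  let ?D = "\<lambda>W. body_area (U + V + W) + body_area U + body_area V + body_area W
    - body_area (U + V) - body_area (U + W) - body_area (V + W)"
  have small: "\<bar>?D W\<bar> \<le> e" if "0 < e" for e
  proof -
    have e: "0 < e / 2" using that by simp
    obtain d1 where d1: "0 < d1" "\<And>Z. (\<And>z. z \<in> body Z \<Longrightarrow> \<exists>w\<in>body W. dist w z < d1)
        \<Longrightarrow> body_area (U + V + Z) < body_area (U + V + W) + e / 2"
      using body_area_semicontinuous[OF e, of W "U + V"] by blast
    obtain d2 where d2: "0 < d2" "\<And>Z. (\<And>z. z \<in> body Z \<Longrightarrow> \<exists>w\<in>body W. dist w z < d2)
        \<Longrightarrow> body_area (U + Z) < body_area (U + W) + e / 2"
      using body_area_semicontinuous[OF e, of W U] by blast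
    obtain d3 where d3: "0 < d3" "\<And>Z. (\<And>z. z \<in> body Z \<Longrightarrow> \<exists>w\<in>body W. dist w z < d3)
        \<Longrightarrow> body_area (V + Z) < body_area (V + W) + e / 2"
      using body_area_semicontinuous[OF e, of W V] by blast
    obtain d4 where d4: "0 < d4" "\<And>Z. (\<And>z. z \<in> body Z \<Longrightarrow> \<exists>w\<in>body W. dist w z < d4)
        \<Longrightarrow> body_area (0 + Z) < body_area (0 + W) + e / 2"
      using body_area_semicontinuous[OF e, of W 0] by blast
    define d where "d = min (min d1 d2) (min d3 d4) / 2"
    have d: "0 < d" "d < d1" "d < d2" "d < d3" "d < d4" using d1 d2 d3 d4 by (auto simp: d_def)
    obtain Z where Z: "area_additive Z" "body W \<subseteq> body Z"
      "\<And>z. z \<in> body Z \<Longrightarrow> \<exists>w\<in>body W. dist w z \<le> d"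
      using outer_approximation[OF d(1)] by metis
    have near: "\<exists>w\<in>body W. dist w z < d'" if "z \<in> body Z" "d < d'" for z d'
      using Z(3)[OF that(1)] that(2) le_less_trans by blast
    have up: "body_area (U + V + Z) < body_area (U + V + W) + e / 2"
      "body_area (U + Z) < body_area (U + W) + e / 2"
      "body_area (V + Z) < body_area (V + W) + e / 2"
      "body_area Z < body_area W + e / 2"
      using d1(2)[OF near[OF _ d(2)]] d2(2)[OF near[OF _ d(3)]] d3(2)[OF near[OF _ d(4)]]
        d4(2)[OF near[OF _ d(5)]] by simp_all
    have low: "body_area (K + W) \<le> body_area (K + Z)" for K
      using Z(2) by (intro body_area_mono) (simp add: plus_sym_body.rep_eq set_plus_mono2)
    have "?D Z = 0" using Z(1) unfolding area_additive_def by (simp add: algebra_simps)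
    then show ?thesis using up low[of "U + V"] low[of U] low[of V] low[of 0] by simp
  qed
  have "?D W = 0"
  proof (rule ccontr)
    assume "?D W \<noteq> 0"
    then show False using small[of "\<bar>?D W\<bar> / 2"] by simp
  qed
  then show "body_area (U + V + W) + body_area U + body_area V + body_area W
    = body_area (U + V) + body_area (U + W) + body_area (V + W)" by simp
qed

subsection \<open>Mixed area\<close>

definition mixed_area :: "sym_body \<Rightarrow> sym_body \<Rightarrow> real" where
  "mixed_area U V = (body_area (U + V) - body_area U - body_area V) / 2"

lemma body_area_plus: "body_area (U + V) = body_area U + body_area V + 2 * mixed_area U V"
  by (simp add: mixed_area_def field_simps)

lemma mixed_area_commute: "mixed_area U V = mixed_area V U"
  by (simp add: mixed_area_def add.commute)

lemma mixed_area_plus_left: "mixed_area (U + V) W = mixed_area U W + mixed_area V W"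
  using area_additive_all[of W, unfolded area_additive_def, rule_format, of U V]
  by (simp add: mixed_area_def field_simps)

lemma mixed_area_plus_right: "mixed_area W (U + V) = mixed_area W U + mixed_area W V"
  by (metis mixed_area_commute mixed_area_plus_left)

lemma mixed_area_zero_right: "mixed_area U 0 = 0"
  by (simp add: mixed_area_def body_area_zero)

lemma mixed_area_of_nat: "mixed_area U (scale_body (real n) V) = real n * mixed_area U V"
proof (induction n)
  case 0
  then show ?case by (simp add: scale_body_zero mixed_area_zero_right)
next
  case (Suc n)
  have "scale_body (real (Suc n)) V = scale_body (real n) V + V"
    using scale_body_add_left[of "real n" 1 V] by (simp add: scale_body_one add.commute)
  then show ?case using Suc by (simp add: mixed_area_plus_right distrib_right)
qed

section \<open>Monotonicity and homogeneity of the mixed area\<close>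

lemma nonpos_if_multiples_bounded:
  fixes x c :: real
  assumes "\<And>n :: nat. real n * x \<le> c"
  shows "x \<le> 0"
proof (rule ccontr)
  assume "\<not> x \<le> 0"
  then obtain n :: nat where "c < real n * x" using reals_Archimedean3[of x] by auto
  then show False using assms[of n] by simp
qed

text \<open>Compare the areas of \<open>U + n W\<close> and \<open>V + n W\<close>: the area of
  \<open>n W\<close> cancels, and the terms linear in \<open>n\<close> decide for large
  \<open>n\<close>.\<close>

lemma mixed_area_mono:
  assumes "body U \<subseteq> body V"
  shows "mixed_area U W \<le> mixed_area V W"
proof -
  have "real n * (2 * mixed_area U W - 2 * mixed_area V W) \<le> body_area V - body_area U" for n
  proof -
    have "body_area (U + scale_body (real n) W) \<le> body_area (V + scale_body (real n) W)"
      using assms by (intro body_area_mono) (simp add: plus_sym_body.rep_eq set_plus_mono2)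
    then show ?thesis by (simp add: body_area_plus mixed_area_of_nat algebra_simps)
  qed
  then show ?thesis using nonpos_if_multiples_bounded by fastforce
qed

lemma mixed_area_nonneg: "0 \<le> mixed_area U V"
  using mixed_area_mono[of 0 U V] zero_in_body[of U] mixed_area_zero_right[of V]
  by (simp add: zero_sym_body.rep_eq mixed_area_commute)

text \<open>Cauchy's functional equation on the half line: nonnegativity makes \<open>f\<close>
  monotone, which extends homogeneity from natural to real factors.\<close>

lemma additive_nonneg_imp_linear:
  fixes f :: "real \<Rightarrow> real"
  assumes add: "\<And>r s. 0 \<le> r \<Longrightarrow> 0 \<le> s \<Longrightarrow> f (r + s) = f r + f s"
    and nonneg: "\<And>r. 0 \<le> r \<Longrightarrow> 0 \<le> f r" and r: "0 \<le> r"
  shows "f r = r * f 1"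
proof -
  have mult: "f (real n * s) = real n * f s" if "0 \<le> s" for n s
  proof (induction n)
    case 0
    then show ?case using add[of 0 0] by simp
  next
    case (Suc n)
    then show ?case using add[of "real n * s" s] that by (simp add: distrib_right add.commute)
  qed
  have mono: "f s \<le> f t" if "0 \<le> s" "s \<le> t" for s t
    using add[of s "t - s"] nonneg[of "t - s"] that by simp
  have bound: "real n * (f r - r * f 1) \<le> f 1" "real n * (r * f 1 - f r) \<le> f 1" for n
  proof -
    \<comment> \<open>Enclosing \<open>real n * r\<close> between consecutive integers encloses
      \<open>real n * f r\<close> and \<open>real n * r * f 1\<close> in one interval of length
      \<open>f 1\<close>, independent of \<open>n\<close>.\<close>
    define k where "k = nat \<lfloor>real n * r\<rfloor>"
    have "0 \<le> real n * r" using r by simp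
    then have k: "real k \<le> real n * r" "real n * r \<le> real (Suc k)"
      unfolding k_def by linarith+
    have "real k * f 1 \<le> real n * f r" "real n * f r \<le> real (Suc k) * f 1"
      using mono[OF _ k(1)] mono[OF _ k(2)] mult[of 1 k] mult[of 1 "Suc k"] mult[OF r, of n] r
      by simp_all
    moreover have "real k * f 1 \<le> (real n * r) * f 1" "(real n * r) * f 1 \<le> real (Suc k) * f 1"
      using k nonneg[of 1] by (intro mult_right_mono; simp)+
    ultimately show "real n * (f r - r * f 1) \<le> f 1" "real n * (r * f 1 - f r) \<le> f 1"
      by (simp_all add: algebra_simps)
  qed
  show ?thesis
    using nonpos_if_multiples_bounded[OF bound(1)] nonpos_if_multiples_bounded[OF bound(2)] by simp
qed

lemma mixed_area_scale_right:
  assumes "0 \<le> r"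
  shows "mixed_area U (scale_body r V) = r * mixed_area U V"
  using additive_nonneg_imp_linear[of "\<lambda>r. mixed_area U (scale_body r V)", OF _ _ assms]
  by (simp add: scale_body_add_left mixed_area_plus_right mixed_area_nonneg scale_body_one)

lemma body_area_scale_body: "body_area (scale_body r V) = r\<^sup>2 * body_area V"
  using measure_lebesgue_affine[of r 0 "body V"] by (simp add: body_area_def scale_body.rep_eq)

lemma mixed_area_self: "mixed_area U U = body_area U"
proof -
  have "U + U = scale_body 2 U" using scale_body_add_left[of 1 1 U] by (simp add: scale_body_one)
  then show ?thesis by (simp add: mixed_area_def body_area_scale_body)
qed

section \<open>Perimeter and area of classes as mixed areas\<close>

lemma body_area_unit_disc: "body_area unit_disc = pi"
  by (simp add: body_area_def unit_disc.rep_eq content_cball_conv_ball circle_area)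

text \<open>Steiner's formula is the expansion of the area of \<open>U + r B\<close> by mixed areas;
  its instance \<open>r = 1\<close> already determines the coefficient.\<close>

lemma body_perimeter_eq: "body_perimeter U = 2 * mixed_area U unit_disc"
  unfolding body_perimeter_def
proof (rule the_equality)
  show "\<forall>r\<ge>0. body_area (U + scale_body r unit_disc)
      = body_area U + r * (2 * mixed_area U unit_disc) + r\<^sup>2 * body_area unit_disc"
    by (simp add: body_area_plus mixed_area_scale_right body_area_scale_body)
  fix c assume "\<forall>r\<ge>0. body_area (U + scale_body r unit_disc)
      = body_area U + r * c + r\<^sup>2 * body_area unit_disc"
  from this[rule_format, of 1] show "c = 2 * mixed_area U unit_disc"
    by (simp add: body_area_plus scale_body_one)
qed

text \<open>For another representative, \<open>U + Q = V + P\<close> yields a linear relation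
  between mixed areas with any \<open>W\<close>. Testing it with \<open>U\<close>, \<open>V\<close>,
  \<open>P\<close> and \<open>Q\<close> gives independence of the representative.\<close>

lemma vec_area_eq: "vec_area (sym_class U V) = body_area U + body_area V - 2 * mixed_area U V"
  unfolding vec_area_def
proof (rule the_equality)
  have "2 * body_area P + 2 * body_area Q - body_area (P + Q)
      = body_area U + body_area V - 2 * mixed_area U V" if "U + Q = V + P" for P Q
  proof -
    have "mixed_area U W + mixed_area Q W = mixed_area V W + mixed_area P W" for W
      using that by (metis mixed_area_plus_left)
    from this[of U] this[of V] this[of P] this[of Q] show ?thesis
      by (simp add: body_area_plus mixed_area_self mixed_area_commute[of Q]
          mixed_area_commute[of P U] mixed_area_commute[of P V] mixed_area_commute[of V U])
  qed
  then show "\<forall>P Q. sym_class U V = sym_class P Q \<longrightarrow>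
      body_area U + body_area V - 2 * mixed_area U V = 2 * body_area P + 2 * body_area Q - body_area (P + Q)"
    by (simp add: sym_class_eq_iff)
  fix a assume "\<forall>P Q. sym_class U V = sym_class P Q \<longrightarrow>
      a = 2 * body_area P + 2 * body_area Q - body_area (P + Q)"
  then have "a = 2 * body_area U + 2 * body_area V - body_area (U + V)" by blast
  then show "a = body_area U + body_area V - 2 * mixed_area U V" by (simp add: body_area_plus)
qed

lemma vec_perimeter_eq:
  "vec_perimeter (sym_class U V) = 2 * mixed_area U unit_disc - 2 * mixed_area V unit_disc"
  unfolding vec_perimeter_def
proof (rule the_equality)
  have "mixed_area U W + mixed_area Q W = mixed_area V W + mixed_area P W" if "U + Q = V + P" for P Q W
    using that by (metis mixed_area_plus_left)
  then show "\<forall>P Q. sym_class U V = sym_class P Q \<longrightarrow>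
      2 * mixed_area U unit_disc - 2 * mixed_area V unit_disc = body_perimeter P - body_perimeter Q"
    by (simp add: sym_class_eq_iff body_perimeter_eq) (smt (verit))
  fix c assume "\<forall>P Q. sym_class U V = sym_class P Q \<longrightarrow> c = body_perimeter P - body_perimeter Q"
  then show "c = 2 * mixed_area U unit_disc - 2 * mixed_area V unit_disc"
    by (simp add: body_perimeter_eq)
qed

subsection \<open>Bodies of equal perimeter\<close>

text \<open>A maximum of linear functions is convex, and a finite convex function on the whole plane
  is continuous.\<close>

lemma continuous_on_supp: "continuous_on S (supp U)"
proof -
  have "convex_on UNIV (supp U)"
  proof (rule convex_onI)
    fix t :: real and x y :: "real^2" assume t: "0 < t" "t < 1"
    obtain z where z: "z \<in> body U" "supp U ((1 - t) *\<^sub>R x + t *\<^sub>R y) = z \<bullet> ((1 - t) *\<^sub>R x + t *\<^sub>R y)"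
      by (rule supp_attained)
    then show "supp U ((1 - t) *\<^sub>R x + t *\<^sub>R y) \<le> (1 - t) * supp U x + t * supp U y"
      using t by (auto simp: inner_add_right intro!: add_mono mult_left_mono supp_upper)
  qed simp
  then have "continuous_on UNIV (supp U)" by (intro convex_on_continuous) auto
  then show ?thesis using continuous_on_subset by blast
qed

lemma supp_scaleR:
  assumes "0 \<le> r"
  shows "supp U (r *\<^sub>R u) = r * supp U u"
proof -
  obtain x where x: "x \<in> body U" "supp U u = x \<bullet> u" by (rule supp_attained)
  show ?thesis
    by (rule supp_eqI[OF x(1)]) (use assms x(2) supp_upper[of _ U u] in \<open>auto intro!: mult_left_mono\<close>)
qed

text \<open>On the compact unit circle the gap between the support functions has a positive minimum
  \<open>e\<close>. By homogeneity \<open>U + e B\<close> is contained in \<open>V\<close>, and the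
  summand \<open>e B\<close> contributes \<open>e * pi\<close> to the mixed area with the
  disc.\<close>

lemma mixed_area_unit_disc_strict_mono:
  assumes less: "\<And>u. norm u = 1 \<Longrightarrow> supp U u < supp V u"
  shows "mixed_area U unit_disc < mixed_area V unit_disc"
proof -
  let ?S = "sphere (0 :: real^2) 1"
  have "?S \<noteq> {}" by simp
  moreover have "continuous_on ?S (\<lambda>u. supp V u - supp U u)"
    by (intro continuous_on_diff continuous_on_supp)
  ultimately obtain w where w: "w \<in> ?S" "\<And>u. u \<in> ?S \<Longrightarrow> supp V w - supp U w \<le> supp V u - supp U u"
    using continuous_attains_inf[of ?S "\<lambda>u. supp V u - supp U u"] by auto
  define e where "e = supp V w - supp U w"
  have e: "0 < e" using less w(1) by (simp add: e_def)
  have "supp (U + scale_body e unit_disc) u \<le> supp V u" for u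
  proof (cases "u = 0")
    case True
    then show ?thesis using supp_scaleR[of 0 _ u] by simp
  next
    case False
    define v where "v = u /\<^sub>R norm u"
    have v: "u = norm u *\<^sub>R v" "norm v = 1" using False by (simp_all add: v_def)
    then have "supp U v + e \<le> supp V v" using w(2)[of v] by (simp add: e_def)
    then have "norm u * (supp U v + e) \<le> norm u * supp V v" by (intro mult_left_mono) simp_all
    then have "supp U (norm u *\<^sub>R v) + e * norm u \<le> supp V (norm u *\<^sub>R v)"
      by (simp add: supp_scaleR algebra_simps)
    then show ?thesis
      using e v(1) by (simp add: supp_plus supp_scale_body supp_unit_disc)
  qed
  then have "mixed_area (U + scale_body e unit_disc) unit_disc \<le> mixed_area V unit_disc"
    by (intro mixed_area_mono) (simp add: body_subset_iff)
  moreover have "mixed_area (scale_body e unit_disc) unit_disc = e * pi"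
    using e by (simp add: mixed_area_commute[of "scale_body _ _"] mixed_area_scale_right
        mixed_area_self body_area_unit_disc)
  moreover have "0 < e * pi" using e by simp
  ultimately show ?thesis by (simp add: mixed_area_plus_left)
qed

lemma eq_supp_if_eq_perimeter:
  assumes eq: "mixed_area U unit_disc = mixed_area V unit_disc"
  obtains u where "norm u = 1" "supp U u = supp V u"
proof -
  let ?f = "\<lambda>u. supp U u - supp V u"
  \<comment> \<open>Strict domination around the whole circle would make the perimeters differ, so
    \<open>?f\<close> takes a value of each weak sign and, the circle being connected, the value
    0.\<close>
  have "\<not> (\<forall>u. norm u = 1 \<longrightarrow> supp U u < supp V u)" "\<not> (\<forall>u. norm u = 1 \<longrightarrow> supp V u < supp U u)"
    using mixed_area_unit_disc_strict_mono[of U V] mixed_area_unit_disc_strict_mono[of V U] eq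
    by (metis less_irrefl)+
  then obtain u v where "norm v = 1" "0 \<le> ?f v" "norm u = 1" "?f u \<le> 0" by (auto simp: not_less)
  then have "?f u \<in> ?f ` sphere 0 1" "?f v \<in> ?f ` sphere 0 1" "?f u \<le> 0" "0 \<le> ?f v" by simp_all
  moreover have "connected (?f ` sphere 0 1)"
    by (intro connected_continuous_image connected_sphere continuous_on_diff continuous_on_supp) simp
  ultimately have "0 \<in> ?f ` sphere 0 1"
    by (rule connectedD_interval[rotated])
  then show thesis using that by auto
qed

lemma body_area_le_if_eq_perimeter:
  assumes "mixed_area U unit_disc = mixed_area V unit_disc"
  shows "body_area U + body_area V \<le> 2 * mixed_area U V"
proof -
  obtain u where "norm u = 1" "supp U u = supp V u" using eq_supp_if_eq_perimeter[OF assms] .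
  from body_area_plus_ge_of_eq_supp[OF this] show ?thesis by (simp add: body_area_plus)
qed

lemma isoperimetric_difference:
  assumes le: "mixed_area V unit_disc \<le> mixed_area U unit_disc"
  shows "pi * (body_area U + body_area V - 2 * mixed_area U V)
    \<le> (mixed_area U unit_disc - mixed_area V unit_disc)\<^sup>2"
proof -
  \<comment> \<open>\<open>mixed_area unit_disc unit_disc = pi\<close>, so this \<open>c\<close>
    gives \<open>V + c B\<close> the same perimeter as \<open>U\<close>.\<close>
  define c where "c = (mixed_area U unit_disc - mixed_area V unit_disc) / pi"
  have c: "0 \<le> c" "c * pi = mixed_area U unit_disc - mixed_area V unit_disc"
    using le by (simp_all add: c_def)
  let ?V = "V + scale_body c unit_disc"
  have "mixed_area ?V unit_disc = mixed_area U unit_disc"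
    using c by (simp add: mixed_area_plus_left mixed_area_commute[of "scale_body _ _"]
        mixed_area_scale_right mixed_area_self body_area_unit_disc)
  then have "body_area U + body_area ?V \<le> 2 * mixed_area U ?V"
    by (intro body_area_le_if_eq_perimeter) simp
  \<comment> \<open>Expanding both sides, \<open>c\<^sup>2 * pi\<close> is the area of
    \<open>c B\<close>, and the terms linear in \<open>c\<close> are its mixed areas with
    \<open>U\<close> and \<open>V\<close>.\<close>
  then have "body_area U + body_area V - 2 * mixed_area U V
      \<le> 2 * c * (mixed_area U unit_disc - mixed_area V unit_disc) - c\<^sup>2 * pi"
    using c(1) by (simp add: body_area_plus mixed_area_plus_right mixed_area_scale_right
        body_area_scale_body body_area_unit_disc algebra_simps)
  also have "\<dots> = c\<^sup>2 * pi" by (simp add: c(2)[symmetric] power2_eq_square)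
  finally have "pi * (body_area U + body_area V - 2 * mixed_area U V) \<le> pi * (c\<^sup>2 * pi)"
    by (intro mult_left_mono) simp_all
  also have "\<dots> = (c * pi)\<^sup>2" by (simp add: power2_eq_square)
  finally show ?thesis by (simp add: c(2))
qed

theorem theorem9:
  fixes U V :: sym_body
  shows "(vec_perimeter (sym_class U V))\<^sup>2 \<ge> 4 * pi * vec_area (sym_class U V)"
proof -
  \<comment> \<open>Both sides are symmetric in \<open>U\<close> and \<open>V\<close>, so the body
    of larger perimeter may take the role of \<open>U\<close>.\<close>
  have "pi * (body_area U + body_area V - 2 * mixed_area U V)
    \<le> (mixed_area U unit_disc - mixed_area V unit_disc)\<^sup>2"
    using isoperimetric_difference[of V U] isoperimetric_difference[of U V]
    by (cases "mixed_area V unit_disc \<le> mixed_area U unit_disc")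
      (simp_all add: mixed_area_commute[of V U] power2_commute add.commute)
  moreover have "(2 * mixed_area U unit_disc - 2 * mixed_area V unit_disc)\<^sup>2
    = 4 * (mixed_area U unit_disc - mixed_area V unit_disc)\<^sup>2"
    by (simp add: power2_eq_square algebra_simps)
  ultimately show ?thesis by (simp add: vec_area_eq vec_perimeter_eq)
qed

end
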